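(* There exists an absolute constant $C>0$ such that for every positive integer $k$, every finite sequence of distinct real numbers can, after deleting at most $(k-1)^2$ of its entries, be partitioned into at most $C k^2\log (k+1)$ block-monotone subsequences, each of depth at least $k$.
   Context: A subsequence need not consist of consecutive entries. A sequence $(a_1,a_2,\dots,a_{ks})$ of $ks$ distinct real numbers ($k,s$ positive integers) is \emph{block-increasing} (resp. \emph{block-decreasing}) with \emph{depth} $k$ and \emph{block-size} $s$ if every subsequence $(a_{i_1},a_{i_2},\dots,a_{i_k})$ with $(j-1)s<i_j\le js$ for each $j=1,\dots,k$ is increasing (resp. decreasing). A sequence is \emph{block-monotone} if it is block-increasing or block-decreasing. Partitioning a sequence into subsequences means that each entry (index) belongs to exactly one of the subsequences. Different subsequences in the partition may have different depths and block-sizes. *)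

theory Defs
  imports Complex_Main "HOL-Library.Disjoint_Sets"
begin

text \<open>
  Finite sequences are lists, indexed from 0, so the j-th block (j < k) of block-size s
  occupies the indices from j * s to (j + 1) * s - 1. A choice of one index from each of the
  k blocks is a function of which only the values on \<open>{..<k}\<close> matter.
\<close>

definition block_transversal :: "nat \<Rightarrow> nat \<Rightarrow> (nat \<Rightarrow> nat) \<Rightarrow> bool" where
  "block_transversal k s i \<longleftrightarrow> (\<forall>j<k. j * s \<le> i j \<and> i j < (j + 1) * s)"

definition block_increasing :: "nat \<Rightarrow> nat \<Rightarrow> real list \<Rightarrow> bool" where
  "block_increasing k s a \<longleftrightarrow>
     0 < k \<and> 0 < s \<and> length a = k * s \<and> distinct a \<and>
     (\<forall>i. block_transversal k s i \<longrightarrow> sorted_wrt (<) (map (\<lambda>j. a ! i j) [0..<k]))"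

definition block_decreasing :: "nat \<Rightarrow> nat \<Rightarrow> real list \<Rightarrow> bool" where
  "block_decreasing k s a \<longleftrightarrow>
     0 < k \<and> 0 < s \<and> length a = k * s \<and> distinct a \<and>
     (\<forall>i. block_transversal k s i \<longrightarrow> sorted_wrt (>) (map (\<lambda>j. a ! i j) [0..<k]))"

definition block_monotone :: "nat \<Rightarrow> nat \<Rightarrow> real list \<Rightarrow> bool" where
  "block_monotone k s a \<longleftrightarrow> block_increasing k s a \<or> block_decreasing k s a"

end

theory Submission
  imports Defs
begin

text \<open>
  Identify a sequence with the set of its indices. Among the points with equal Erdos-Szekeres
  labels (depths of the longest chains of blocks of size \<open>s\<close> ending before the point) no two may
  span a rectangle containing \<open>s\<close> others, so \<open>5 s k\<^sup>2\<close> points contain a block-monotone set of depth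
  \<open>k\<close> and block-size \<open>s\<close>. Such sets can be removed greedily: \<open>O(k log k)\<close> of them reduce a set by a
  factor of order \<open>k\<^sup>2\<close>.

  Now set aside a chain of depth \<open>3 k\<close> with large blocks, say an increasing one, and reduce the
  rest below its block-size. A remaining point extends the first or the last third of the chain to
  a longer chain and can be absorbed there, or it is in decreasing position to the whole middle
  third. Keep the middle third and continue with the points of the second kind. After \<open>2 k\<close> rounds,
  \<open>k\<close> of the chains kept have the same direction; together with any remaining point these chains
  form a monotone configuration in the opposite direction, which absorbs all remaining points.
\<close>

section \<open>Block chains as sets of indices\<close>

text \<open>The strict product order on the points \<open>(p, v p)\<close> of the plane. Decreasing
  configurations are increasing ones for \<open>- v\<close>, so both directions are treated at once
  by letting \<open>w\<close> range over \<open>{v, - v}\<close>.\<close>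

definition below :: "(nat \<Rightarrow> real) \<Rightarrow> nat \<Rightarrow> nat \<Rightarrow> bool" where
  "below v p q \<longleftrightarrow> p < q \<and> v p < v q"

definition precedes :: "(nat \<Rightarrow> real) \<Rightarrow> nat set \<Rightarrow> nat set \<Rightarrow> bool" where
  "precedes v A B \<longleftrightarrow> (\<forall>p\<in>A. \<forall>q\<in>B. below v p q)"

definition block_chain :: "(nat \<Rightarrow> real) \<Rightarrow> nat \<Rightarrow> nat \<Rightarrow> (nat \<Rightarrow> nat set) \<Rightarrow> bool" where
  "block_chain v d s B \<longleftrightarrow>
     (\<forall>j<d. finite (B j) \<and> card (B j) = s) \<and> (\<forall>i j. i < j \<and> j < d \<longrightarrow> precedes v (B i) (B j))"

definition block_monotone_set :: "(nat \<Rightarrow> real) \<Rightarrow> nat \<Rightarrow> nat set \<Rightarrow> bool" where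
  "block_monotone_set v k I \<longleftrightarrow>
     (\<exists>w\<in>{v, - v}. \<exists>d\<ge>k. \<exists>s\<ge>1. \<exists>B. block_chain w d s B \<and> I = (\<Union>j<d. B j))"

text \<open>Only an upper bound \<open>c\<close> on the number of parts is recorded, so that counts
  can be rounded up and added over disjoint sets.\<close>

definition block_partitionable :: "(nat \<Rightarrow> real) \<Rightarrow> nat \<Rightarrow> nat \<Rightarrow> nat set \<Rightarrow> bool" where
  "block_partitionable v k c R \<longleftrightarrow>
     (\<exists>P. partition_on R P \<and> finite P \<and> card P \<le> c \<and> (\<forall>I\<in>P. block_monotone_set v k I))"

lemma uminus_uminus_fun [simp]: "- (- v) = (v :: nat \<Rightarrow> real)"
  by (simp add: fun_eq_iff)

lemma uminus_mem_orientations: "w \<in> {v, - v} \<Longrightarrow> - w \<in> {v, - v :: nat \<Rightarrow> real}"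
  by auto

lemma below_trans: "below v p q \<Longrightarrow> below v q r \<Longrightarrow> below v p r"
  by (auto simp: below_def)

lemma below_irrefl [simp]: "\<not> below v p p"
  by (simp add: below_def)

lemma below_uminus_contr: "below (- v) p q \<Longrightarrow> below v p q \<or> below v q p \<Longrightarrow> False"
  by (auto simp: below_def)

lemma precedes_mono: "precedes v A B \<Longrightarrow> A' \<subseteq> A \<Longrightarrow> B' \<subseteq> B \<Longrightarrow> precedes v A' B'"
  unfolding precedes_def by blast

lemma block_chain_mono: "block_chain v d s B \<Longrightarrow> e \<le> d \<Longrightarrow> block_chain v e s B"
  unfolding block_chain_def by auto

lemma block_chain_shift:
  "block_chain v d s B \<Longrightarrow> a + e \<le> d \<Longrightarrow> block_chain v e s (\<lambda>j. B (a + j))"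
  unfolding block_chain_def by auto

text \<open>Applied twice whenever equally many points are cut out of every block: to the portions
  taken and to what is left.\<close>

lemma block_chain_subsets:
  assumes "block_chain v d s B" "\<And>j. j < d \<Longrightarrow> C j \<subseteq> B j \<and> card (C j) = t"
  shows "block_chain v d t C"
  using assms finite_subset precedes_mono unfolding block_chain_def
  by (metis order.strict_trans)

lemma block_chain_snoc:
  assumes "block_chain v d s B" "finite T" "card T = s" "precedes v (\<Union>j<d. B j) T"
  shows "block_chain v (Suc d) s (B(d := T))"
  using assms unfolding block_chain_def precedes_def by (auto simp: less_Suc_eq)

lemma block_chain_Cons:
  assumes "block_chain v d s B" "finite T" "card T = s" "precedes v T (\<Union>j<d. B j)"
  shows "block_chain v (Suc d) s (case_nat T B)"
  using assms unfolding block_chain_def precedes_def by (auto split: nat.splits)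

lemma UN_less_Suc_upd: "(\<Union>j<Suc d. (B(d := T)) j) = (\<Union>j<d. B j) \<union> T"
  by (auto simp: less_Suc_eq)

lemma UN_less_Suc_case_nat: "(\<Union>j<Suc d. case_nat T B j) = T \<union> (\<Union>j<d. B j)"
  by (auto simp: lessThan_Suc_eq_insert_0)

lemma finite_block_chain: "block_chain v d s B \<Longrightarrow> finite (\<Union>j<d. B j)"
  by (auto simp: block_chain_def)

lemma block_chain_disjoint:
  assumes "block_chain v d s B" "i < d" "j < d" "i \<noteq> j"
  shows "B i \<inter> B j = {}"
proof -
  have "x \<in> B i \<Longrightarrow> x \<in> B j \<Longrightarrow> False" for x
    using assms unfolding block_chain_def precedes_def
    by (metis below_irrefl nat_neq_iff)
  then show ?thesis by blast
qed

lemma card_block_chain: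
  assumes "block_chain v d s B" shows "card (\<Union>j<d. B j) = d * s"
proof -
  have "card (\<Union>j<d. B j) = (\<Sum>j<d. card (B j))"
    using assms block_chain_disjoint[OF assms]
    by (intro card_UN_disjoint) (auto simp: block_chain_def)
  also have "\<dots> = d * s"
    using assms by (simp add: block_chain_def)
  finally show ?thesis .
qed

text \<open>The set with the largest minimum can only come last, so induction on the number of sets
  sorts the family. This serves families whose order is not known beforehand.\<close>

lemma block_chain_linear_family:
  assumes "finite J" "\<And>i. i \<in> J \<Longrightarrow> finite (A i) \<and> card (A i) = m"
    and "\<And>i j. i \<in> J \<Longrightarrow> j \<in> J \<Longrightarrow> i \<noteq> j \<Longrightarrow> precedes w (A i) (A j) \<or> precedes w (A j) (A i)"
  shows "\<exists>B. block_chain w (card J) m B \<and> (\<Union>j<card J. B j) = (\<Union>i\<in>J. A i)"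
\<comment> \<open>Empty sets have no minimum to sort by.\<close>
proof (cases "m = 0")
  case True
  then have "A i = {}" if "i \<in> J" for i using assms(2)[OF that] by auto
  then have "block_chain w (card J) m (\<lambda>_. {})" "(\<Union>i\<in>J. A i) = {}"
    using True by (simp_all add: block_chain_def precedes_def)
  then show ?thesis by (intro exI[of _ "\<lambda>_. {}"]) simp
next
  case False
  from assms show ?thesis
  proof (induction "card J" arbitrary: J)
    case 0
    then show ?case by (intro exI[of _ "\<lambda>_. {}"]) (auto simp: block_chain_def)
  next
    case (Suc d)
    have ne: "A i \<noteq> {}" if "i \<in> J" for i using Suc.prems(2)[OF that] False by auto
    have "J \<noteq> {}" using Suc.hyps(2) by auto
    then have "Max ((\<lambda>i. Min (A i)) ` J) \<in> (\<lambda>i. Min (A i)) ` J"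
      using Suc.prems(1) by (intro Max_in) auto
    then obtain i where i: "i \<in> J" "Max ((\<lambda>i. Min (A i)) ` J) = Min (A i)" by blast
    have max: "Min (A j) \<le> Min (A i)" if "j \<in> J" for j
      unfolding i(2)[symmetric] using Suc.prems(1) that by (intro Max_ge) auto
    have before: "precedes w (A j) (A i)" if "j \<in> J" "j \<noteq> i" for j
    proof -
      have "\<not> precedes w (A i) (A j)"
      proof
        assume "precedes w (A i) (A j)"
        then have "Min (A i) < Min (A j)"
          using ne[OF that(1)] ne[OF i(1)] Suc.prems(2)[OF that(1)] Suc.prems(2)[OF i(1)]
          unfolding precedes_def below_def by (meson Min_in)
        then show False using max[OF that(1)] by simp
      qed
      then show ?thesis using Suc.prems(3) that i(1) by blast
    qed
    have c: "card (J - {i}) = d" using Suc.hyps(2) Suc.prems(1) i by simp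
    obtain B where B: "block_chain w d m B" "(\<Union>j<d. B j) = (\<Union>i\<in>J - {i}. A i)"
      using Suc.hyps(1)[OF c[symmetric]] Suc.prems c by (metis Diff_iff finite_Diff)
    have "block_chain w (Suc d) m (B(d := A i))"
    proof (rule block_chain_snoc[OF B(1)])
      show "precedes w (\<Union>j<d. B j) (A i)"
        unfolding B(2) using before unfolding precedes_def by blast
    qed (use Suc.prems(2)[OF i(1)] in auto)
    moreover have "(\<Union>j<Suc d. (B(d := A i)) j) = (\<Union>i\<in>J. A i)"
      unfolding UN_less_Suc_upd B(2) using i(1) by auto
    ultimately show ?case unfolding Suc.hyps(2)[symmetric] by blast
  qed
qed

section \<open>Translation from index sets to lists\<close>

lemma nths_eq_map_filter: "nths xs I = map ((!) xs) (filter (\<lambda>i. i \<in> I) [0..<length xs])"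
proof -
  have "zip xs [0..<length xs] = map (\<lambda>i. (xs ! i, i)) [0..<length xs]"
    by (intro nth_equalityI) auto
  then show ?thesis by (simp add: nths_def filter_map comp_def)
qed

text \<open>Every block lies to the left of the next, so sorting the union lists the blocks one
  after the other, each filling \<open>s\<close> positions.\<close>

lemma sorted_list_block_chain_nth:
  assumes "block_chain w d s B" "s \<ge> 1" "m < d * s"
  shows "sorted_list_of_set (\<Union>j<d. B j) ! m \<in> B (m div s)"
  using assms
proof (induction d)
  case 0
  then show ?case by simp
next
  case (Suc d)
  let ?I = "\<Union>j<d. B j"
  have chain: "block_chain w d s B" using Suc.prems(1) block_chain_mono by simp
  have prec: "precedes w ?I (B d)"
    using Suc.prems(1) unfolding block_chain_def precedes_def by blast
  have B: "finite (B d)" "card (B d) = s" using Suc.prems(1) by (auto simp: block_chain_def)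
  have fin: "finite ?I" using finite_block_chain[OF chain] .
  have len: "length (sorted_list_of_set ?I) = d * s" using card_block_chain[OF chain] by simp
  have "sorted_list_of_set ?I @ sorted_list_of_set (B d) = sorted_list_of_set (?I \<union> B d)"
  proof (rule sorted_distinct_set_unique)
    show "sorted (sorted_list_of_set ?I @ sorted_list_of_set (B d))"
      "distinct (sorted_list_of_set ?I @ sorted_list_of_set (B d))"
      using prec fin B by (fastforce simp: sorted_append precedes_def below_def)+
  qed (use fin B in auto)
  moreover have "(\<Union>j<Suc d. B j) = ?I \<union> B d" by (auto simp: less_Suc_eq)
  ultimately have eq: "sorted_list_of_set (\<Union>j<Suc d. B j) = sorted_list_of_set ?I @ sorted_list_of_set (B d)"
    by simp
  show ?case
  proof (cases "m < d * s")
    case True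
    then show ?thesis using Suc.IH[OF chain Suc.prems(2)] by (simp add: eq nth_append len del: length_sorted_list_of_set)
  next
    case False
    then have "m div s = d" "m - d * s < s" using Suc.prems
      by (auto intro!: div_nat_eqI simp: algebra_simps)
    moreover have "sorted_list_of_set (B d) ! (m - d * s) \<in> set (sorted_list_of_set (B d))"
      by (rule nth_mem) (use B \<open>m - d * s < s\<close> in auto)
    ultimately show ?thesis using False B by (simp add: eq nth_append len del: length_sorted_list_of_set)
  qed
qed

text \<open>A position in the \<open>j\<close>-th window has quotient \<open>j\<close> by
  \<open>s\<close>, so a transversal picks one point from every \<open>B j\<close>.\<close>

lemma sorted_wrt_transversal_chain:
  assumes "block_chain w d s B" "s \<ge> 1" "(\<Union>j<d. B j) \<subseteq> {..<length xs}" "block_transversal d s i"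
  shows "sorted_wrt (\<lambda>p q. w p < w q)
    (map (\<lambda>j. sorted_list_of_set (\<Union>j<d. B j) ! i j) [0..<d])"
proof -
  have "sorted_list_of_set (\<Union>j<d. B j) ! i j \<in> B j" if "j < d" for j
  proof -
    have "j * s \<le> i j" "i j < Suc j * s" using assms(4) that by (auto simp: block_transversal_def)
    moreover have "Suc j * s \<le> d * s" using that by (intro mult_le_mono1) simp
    ultimately have "i j div s = j" "i j < d * s"
      by (auto intro!: div_nat_eqI simp: algebra_simps)
    then show ?thesis using sorted_list_block_chain_nth[OF assms(1,2)] by metis
  qed
  then have "w (sorted_list_of_set (\<Union>j<d. B j) ! i a) < w (sorted_list_of_set (\<Union>j<d. B j) ! i b)"
    if "a < b" "b < d" for a b
    using assms(1) that unfolding block_chain_def precedes_def below_def by (meson order.strict_trans)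
  then show ?thesis by (simp add: sorted_wrt_iff_nth_less)
qed

text \<open>\<open>nths xs I\<close> reads the entries of \<open>I\<close> by increasing index, so
  its windows are exactly the blocks of the chain. The orientation \<open>w = - (!) xs\<close>
  yields the decreasing case.\<close>

lemma block_monotone_nths:
  assumes "distinct xs" "k \<ge> 1" "I \<subseteq> {..<length xs}" "block_monotone_set ((!) xs) k I"
  shows "\<exists>d s. d \<ge> k \<and> block_monotone d s (nths xs I)"
proof -
  obtain w d s B where w: "w \<in> {(!) xs, - (!) xs}" and d: "d \<ge> k" and s: "s \<ge> 1"
    and B: "block_chain w d s B" and I: "I = (\<Union>j<d. B j)"
    using assms(4) unfolding block_monotone_set_def by blast
  have fin: "finite I" using assms(3) finite_subset by blast
  have "filter (\<lambda>i. i \<in> I) [0..<length xs] = sorted_list_of_set I"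
    by (rule sorted_distinct_set_unique) (use assms(3) fin in \<open>auto intro: sorted_wrt_filter\<close>)
  then have eq: "nths xs I = map ((!) xs) (sorted_list_of_set I)"
    by (simp add: nths_eq_map_filter)
  have len: "length (sorted_list_of_set I) = d * s" using card_block_chain[OF B] I by simp
  have dist: "distinct (nths xs I)" using assms(1) by (rule distinct_nthsI)
  have *: "sorted_wrt (\<lambda>p q. w p < w q) (map (\<lambda>j. sorted_list_of_set I ! i j) [0..<d])"
    if "block_transversal d s i" for i
    using sorted_wrt_transversal_chain[OF B s _ that] assms(3) I by simp
  have nth: "map (\<lambda>j. nths xs I ! i j) [0..<d] = map ((!) xs) (map (\<lambda>j. sorted_list_of_set I ! i j) [0..<d])"
    if "block_transversal d s i" for i
  proof -
    have "i j < d * s" if "j < d" for j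
    proof -
      have "i j < Suc j * s" using \<open>block_transversal d s i\<close> that by (auto simp: block_transversal_def)
      also have "\<dots> \<le> d * s" using that by (intro mult_le_mono1) simp
      finally show ?thesis .
    qed
    then show ?thesis by (simp add: eq len del: length_sorted_list_of_set)
  qed
  have "block_monotone d s (nths xs I)"
  proof (cases "w = (!) xs")
    case True
    have "sorted_wrt (<) (map (\<lambda>j. nths xs I ! i j) [0..<d])" if "block_transversal d s i" for i
      unfolding nth[OF that] using *[OF that] unfolding sorted_wrt_map True .
    then have "block_increasing d s (nths xs I)"
      using d s dist len assms(2) unfolding block_increasing_def by (simp add: eq)
    then show ?thesis by (simp add: block_monotone_def)
  next
    case False
    have "w = - (!) xs" using False w by simp
    have "sorted_wrt (>) (map (\<lambda>j. nths xs I ! i j) [0..<d])" if "block_transversal d s i" for i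
      unfolding nth[OF that] using *[OF that] unfolding sorted_wrt_map \<open>w = - (!) xs\<close> by simp
    then have "block_decreasing d s (nths xs I)"
      using d s dist len assms(2) unfolding block_decreasing_def by (simp add: eq)
    then show ?thesis by (simp add: block_monotone_def)
  qed
  then show ?thesis using d by blast
qed

section \<open>Counting parts: unions and absorption\<close>

lemma block_partitionable_empty: "block_partitionable v k 0 {}"
  unfolding block_partitionable_def by (intro exI[of _ "{}"]) (simp add: partition_on_def)

lemma block_partitionable_mono:
  "block_partitionable v k c R \<Longrightarrow> c \<le> c' \<Longrightarrow> block_partitionable v k c' R"
  unfolding block_partitionable_def by (meson order_trans)

lemma block_partitionable_Un:
  assumes "block_partitionable v k c A" "block_partitionable v k c' B" "A \<inter> B = {}"
  shows "block_partitionable v k (c + c') (A \<union> B)"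
proof -
  obtain P Q where P: "partition_on A P" "finite P" "card P \<le> c" "\<forall>I\<in>P. block_monotone_set v k I"
    and Q: "partition_on B Q" "finite Q" "card Q \<le> c'" "\<forall>I\<in>Q. block_monotone_set v k I"
    using assms(1,2) unfolding block_partitionable_def by blast
  have "partition_on (A \<union> B) (P \<union> Q)" using P(1) Q(1) assms(3)
    by (auto simp: partition_on_def intro: disjoint_union)
  moreover have "card (P \<union> Q) \<le> c + c'" using card_Un_le[of P Q] P(3) Q(3) by linarith
  ultimately show ?thesis using P Q unfolding block_partitionable_def
    by (intro exI[of _ "P \<union> Q"]) auto
qed

lemma block_partitionable_UN:
  assumes "finite G" "\<And>g. g \<in> G \<Longrightarrow> block_partitionable v k (c g) (A g)"
    and "\<And>g h. g \<in> G \<Longrightarrow> h \<in> G \<Longrightarrow> g \<noteq> h \<Longrightarrow> A g \<inter> A h = {}"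
  shows "block_partitionable v k (\<Sum>g\<in>G. c g) (\<Union>g\<in>G. A g)"
  using assms
proof (induction G rule: finite_induct)
  case empty
  then show ?case by (simp add: block_partitionable_empty)
next
  case (insert x F)
  have "block_partitionable v k (c x + (\<Sum>g\<in>F. c g)) (A x \<union> (\<Union>g\<in>F. A g))"
  proof (rule block_partitionable_Un)
    show "block_partitionable v k (c x) (A x)" using insert.prems(1) by simp
    show "block_partitionable v k (\<Sum>g\<in>F. c g) (\<Union>g\<in>F. A g)"
      using insert.IH insert.prems by (metis insert_iff)
    have "A x \<inter> A g = {}" if "g \<in> F" for g
      using insert.prems(2)[of x g] that insert.hyps(2) by blast
    then show "A x \<inter> (\<Union>g\<in>F. A g) = {}" by blast
  qed
  then show ?case using insert.hyps by simp
qed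

text \<open>A nonempty chain is a single part. An empty one, which arises from blocks of size 0, is
  covered by the empty partition.\<close>

lemma block_partitionable_chain:
  assumes "w \<in> {v, - v}" "block_chain w d s B" "1 \<le> k" "k \<le> d"
  shows "block_partitionable v k 1 (\<Union>j<d. B j)"
proof (cases "s = 0")
  case True
  then have "(\<Union>j<d. B j) = {}" using card_block_chain[OF assms(2)] finite_block_chain[OF assms(2)] by simp
  then show ?thesis using block_partitionable_mono[OF block_partitionable_empty] by simp
next
  case False
  let ?I = "\<Union>j<d. B j"
  have "?I \<noteq> {}" using card_block_chain[OF assms(2)] False assms(3,4)
    by (metis card.empty le_trans mult_is_0 not_one_le_zero)
  moreover have "block_monotone_set v k ?I"
  proof -
    have "1 \<le> s" using False by simp
    then show ?thesis unfolding block_monotone_set_def using assms(1,2,4) by blast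
  qed
  ultimately show ?thesis unfolding block_partitionable_def
    by (intro exI[of _ "{?I}"]) (simp add: partition_on_def)
qed

text \<open>Take \<open>card N\<close> points out of each block. With \<open>N\<close> as a further
  block they form a chain of depth \<open>k + 1\<close>, and what remains of the blocks is a chain
  with blocks of size \<open>s - card N\<close>: two parts in all.\<close>

lemma block_partitionable_absorb:
  assumes w: "w \<in> {v, - v}" and B: "block_chain w k s B" and k: "1 \<le> k"
    and N: "finite N" "card N \<le> s"
    and sep: "precedes w (\<Union>j<k. B j) N \<or> precedes w N (\<Union>j<k. B j)"
  shows "block_partitionable v k 2 ((\<Union>j<k. B j) \<union> N)"
proof -
  have "\<exists>C. C \<subseteq> B j \<and> card C = card N" if "j < k" for j
    using that B N by (metis block_chain_def obtain_subset_with_card_n)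
  then obtain C where C: "\<And>j. j < k \<Longrightarrow> C j \<subseteq> B j \<and> card (C j) = card N" by metis
  define D where "D j = B j - C j" for j
  have chainC: "block_chain w k (card N) C" by (rule block_chain_subsets[OF B C])
  have "D j \<subseteq> B j \<and> card (D j) = s - card N" if "j < k" for j
  proof -
    have "finite (B j)" "card (B j) = s" using B that by (auto simp: block_chain_def)
    moreover from this have "finite (C j)" using C[OF that] finite_subset by blast
    ultimately show ?thesis using C[OF that] by (simp add: D_def card_Diff_subset)
  qed
  then have chainD: "block_chain w k (s - card N) D" by (rule block_chain_subsets[OF B])
  have sub: "(\<Union>j<k. C j) \<subseteq> (\<Union>j<k. B j)" using C by fastforce
  have 1: "block_partitionable v k 1 ((\<Union>j<k. C j) \<union> N)"
    using sep
  proof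
    assume "precedes w (\<Union>j<k. B j) N"
    then have "block_chain w (Suc k) (card N) (C(k := N))"
      by (intro block_chain_snoc[OF chainC]) (use N sub precedes_mono in auto)
    from block_partitionable_chain[OF w this k] show ?thesis
      unfolding UN_less_Suc_upd by simp
  next
    assume "precedes w N (\<Union>j<k. B j)"
    then have "block_chain w (Suc k) (card N) (case_nat N C)"
      by (intro block_chain_Cons[OF chainC]) (use N sub precedes_mono in auto)
    from block_partitionable_chain[OF w this k] show ?thesis
      unfolding UN_less_Suc_case_nat by (simp add: Un_commute)
  qed
  have BN: "(\<Union>j<k. B j) \<inter> N = {}"
    using sep unfolding precedes_def using below_irrefl by blast
  have "((\<Union>j<k. C j) \<union> N) \<inter> (\<Union>j<k. D j) = {}"
  proof -
    have "x \<notin> C i" if "x \<in> D j" "i < k" "j < k" for x i j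
      using that block_chain_disjoint[OF B, of i j] C[of i] unfolding D_def by blast
    then show ?thesis using BN unfolding D_def by blast
  qed
  from block_partitionable_Un[OF 1 block_partitionable_chain[OF w chainD k] this]
  have "block_partitionable v k 2 (((\<Union>j<k. C j) \<union> N) \<union> (\<Union>j<k. D j))" by (simp add: numeral_2_eq_2)
  moreover have "((\<Union>j<k. C j) \<union> N) \<union> (\<Union>j<k. D j) = (\<Union>j<k. B j) \<union> N"
    using C unfolding D_def by blast
  ultimately show ?thesis by simp
qed

section \<open>Erdos-Szekeres theorems for block chains\<close>

lemma below_total:
  assumes "inj_on v R" "p \<in> R" "q \<in> R" "p \<noteq> q"
  shows "below v p q \<or> below v q p \<or> below (- v) p q \<or> below (- v) q p"
proof -
  have "v p \<noteq> v q" using assms by (simp add: inj_on_eq_iff)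
  then show ?thesis using assms(4) unfolding below_def by auto
qed

text \<open>Let \<open>l\<close>, \<open>r\<close>, \<open>t\<close>, \<open>b\<close> be the
  leftmost, rightmost, highest and lowest points. Every other point lies inside one of the five
  rectangles spanned by the pairs in \<open>F\<close>. If each of these held at most
  \<open>s - 1\<close> points, there would be at most \<open>4 + 5 * (s - 1) < 5 * s\<close>
  points.\<close>

lemma rectangle_many_points:
  fixes v :: "nat \<Rightarrow> real"
  assumes R: "finite R" "inj_on v R" and n: "card R \<ge> 5 * s" and s: "s \<ge> 1"
  shows "\<exists>w\<in>{v, - v}. \<exists>q\<in>R. \<exists>p\<in>R. \<exists>T\<subseteq>R. card T = s \<and> (\<forall>t\<in>T. below w q t \<and> below w t p)"
proof -
  define box where "box q p = {x \<in> R. q < x \<and> x < p \<and> min (v q) (v p) < v x \<and> v x < max (v q) (v p)}" for q p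
  have ne: "R \<noteq> {}" using n s by auto
  define l r where "l = Min R" and "r = Max R"
  have l: "l \<in> R" "\<And>x. x \<in> R \<Longrightarrow> l \<le> x" and r: "r \<in> R" "\<And>x. x \<in> R \<Longrightarrow> x \<le> r"
    using R ne by (auto simp: l_def r_def)
  have "Max (v ` R) \<in> v ` R" "Min (v ` R) \<in> v ` R" using R ne by auto
  then obtain t b where tb: "t \<in> R" "b \<in> R" "v t = Max (v ` R)" "v b = Min (v ` R)" by (metis imageE)
  have t: "v x \<le> v t" and b: "v b \<le> v x" if "x \<in> R" for x
    using tb R that by auto
  define F where "F = set [(l, t), (t, r), (b, r), (l, b), (l, r)]"
  have cover: "R \<subseteq> {l, r, t, b} \<union> (\<Union>(q, p)\<in>F. box q p)"
  proof
    fix x assume x: "x \<in> R"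
    show "x \<in> {l, r, t, b} \<union> (\<Union>(q, p)\<in>F. box q p)"
    proof (cases "x \<in> {l, r, t, b}")
      case True
      then show ?thesis by blast
    next
      case False
      have ne: "v x \<noteq> v l" "v x \<noteq> v r" "v x \<noteq> v t" "v x \<noteq> v b"
        using False x l(1) r(1) tb R(2) unfolding inj_on_def by auto
      have lr: "l < x" "x < r" and bt: "v x < v t" "v b < v x" "x \<noteq> t" "x \<noteq> b"
        using False ne l(2)[OF x] r(2)[OF x] t[OF x] b[OF x] by auto
      have "x \<in> box l t \<or> x \<in> box t r \<or> x \<in> box b r \<or> x \<in> box l b \<or> x \<in> box l r"
      proof -
        \<comment> \<open>The cases: higher than both \<open>l\<close> and \<open>r\<close>, on
          either side of \<open>t\<close>; lower than both, on either side of \<open>b\<close>;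
          height between those of \<open>l\<close> and \<open>r\<close>.\<close>
        consider "v l < v x" "v r < v x" "x < t" | "v l < v x" "v r < v x" "t < x"
          | "v x < v l" "v x < v r" "x < b" | "v x < v l" "v x < v r" "b < x"
          | "min (v l) (v r) < v x" "v x < max (v l) (v r)"
          using ne bt(3,4) by linarith
        then show ?thesis
          by cases (use x lr bt(1,2) in \<open>simp_all add: box_def min_less_iff_disj less_max_iff_disj\<close>)
      qed
      then show ?thesis unfolding F_def by auto
    qed
  qed
  have "\<exists>(q, p)\<in>F. card (box q p) \<ge> s"
  proof (rule ccontr)
    assume "\<not> ?thesis"
    then have small: "card (case z of (q, p) \<Rightarrow> box q p) \<le> s - 1" if "z \<in> F" for z using that by fastforce
    have "card F \<le> 5" unfolding F_def by (rule order_trans[OF card_length]) simp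
    have "card (\<Union>z\<in>F. case z of (q, p) \<Rightarrow> box q p) \<le> (\<Sum>z\<in>F. card (case z of (q, p) \<Rightarrow> box q p))"
      by (rule card_UN_le) (simp add: F_def)
    also have "\<dots> \<le> card F * (s - 1)" using sum_bounded_above[of F _ "s - 1"] small by simp
    also have "\<dots> \<le> 5 * (s - 1)" using \<open>card F \<le> 5\<close> by (rule mult_le_mono1)
    finally have 1: "card (\<Union>(q, p)\<in>F. box q p) \<le> 5 * (s - 1)" .
    have "card (set [l, r, t, b]) \<le> 4" by (rule order_trans[OF card_length]) simp
    then have "card {l, r, t, b} \<le> 4" unfolding list.set .
    then have "card ({l, r, t, b} \<union> (\<Union>(q, p)\<in>F. box q p)) \<le> 4 + 5 * (s - 1)"
      using 1 card_Un_le[of "{l, r, t, b}" "\<Union>(q, p)\<in>F. box q p"] by linarith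
    moreover have "finite ({l, r, t, b} \<union> (\<Union>(q, p)\<in>F. box q p))"
      using R(1) by (auto simp: F_def box_def)
    ultimately have "card R \<le> 4 + 5 * (s - 1)" using card_mono[OF _ cover] by linarith
    then show False using n s by linarith
  qed
  then obtain q p where qp: "(q, p) \<in> F" "card (box q p) \<ge> s" by blast
  obtain T where T: "T \<subseteq> box q p" "card T = s" using obtain_subset_with_card_n[OF qp(2)] by blast
  have "q \<in> R" "p \<in> R" using qp(1) l r tb unfolding F_def by auto
  have "T \<subseteq> R" using T(1) by (auto simp: box_def)
  show ?thesis
  proof (cases "v q \<le> v p")
    case True
    then have "\<forall>x\<in>T. below v q x \<and> below v x p" using T(1) unfolding box_def below_def by auto
    then show ?thesis using T(2) \<open>q \<in> R\<close> \<open>p \<in> R\<close> \<open>T \<subseteq> R\<close> by blast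
  next
    case False
    then have "\<forall>x\<in>T. below (- v) q x \<and> below (- v) x p" using T(1) unfolding box_def below_def by auto
    then show ?thesis using T(2) \<open>q \<in> R\<close> \<open>p \<in> R\<close> \<open>T \<subseteq> R\<close> by blast
  qed
qed

lemma pigeonhole_class:
  assumes "finite R" "f ` R \<subseteq> L" "finite L" "card R > card L * (N - 1)"
  shows "\<exists>y. card {x \<in> R. f x = y} \<ge> N"
proof (rule ccontr)
  assume "\<not> ?thesis"
  then have less: "card {x \<in> R. f x = y} < N" for y by (simp add: not_le)
  then have small: "card {x \<in> R. f x = y} \<le> N - 1" for y
    using less[of y] by linarith
  have "R = (\<Union>y\<in>L. {x \<in> R. f x = y})" using assms(2) by auto
  then have "card R \<le> (\<Sum>y\<in>L. card {x \<in> R. f x = y})"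
    using card_UN_le[OF assms(3), of "\<lambda>y. {x \<in> R. f x = y}"] by metis
  also have "\<dots> \<le> card L * (N - 1)" using sum_bounded_above[of L _ "N - 1"] small by simp
  finally show False using assms(4) by linarith
qed

text \<open>
  Label each point by the largest depths of an increasing and of a decreasing block chain that
  ends before it. In a class of points with equal labels, the points between \<open>q\<close> and \<open>p\<close> would
  extend every chain ending before \<open>q\<close> to a longer one ending before \<open>p\<close>.
\<close>

lemma deep_chain_below:
  fixes v :: "nat \<Rightarrow> real"
  assumes R: "finite R" and s: "s \<ge> 1" and n: "card R > m\<^sup>2 * (N - 1)"
    and step: "\<And>Q. Q \<subseteq> R \<Longrightarrow> card Q \<ge> N \<Longrightarrow>
      \<exists>w\<in>{v, - v}. \<exists>q\<in>Q. \<exists>p\<in>Q. \<exists>T\<subseteq>Q. card T = s \<and> (\<forall>t\<in>T. (t = q \<or> below w q t) \<and> below w t p)"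
  shows "\<exists>w\<in>{v, - v}. \<exists>p\<in>R. \<exists>B. block_chain w m s B \<and> (\<Union>j<m. B j) \<subseteq> R \<and> precedes w (\<Union>j<m. B j) {p}"
proof (rule ccontr)
  assume no: "\<not> ?thesis"
  define S where "S w p = {d. \<exists>B. block_chain w d s B \<and> (\<Union>j<d. B j) \<subseteq> R \<and> precedes w (\<Union>j<d. B j) {p}}" for w p
  \<comment> \<open>A deeper chain before \<open>p\<close> could be cut down to its first
    \<open>m\<close> blocks. Hence both labels are below \<open>m\<close>, and there are at most
    \<open>m\<^sup>2\<close> pairs of labels.\<close>
  have S_less: "S w p \<subseteq> {..<m}" if "w \<in> {v, - v}" "p \<in> R" for w p
  proof
    fix d assume "d \<in> S w p"
    then obtain B where B: "block_chain w d s B" "(\<Union>j<d. B j) \<subseteq> R" "precedes w (\<Union>j<d. B j) {p}"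
      unfolding S_def by blast
    show "d \<in> {..<m}"
    proof (rule ccontr)
      assume "d \<notin> {..<m}"
      then have "m \<le> d" by simp
      then have sub: "(\<Union>j<m. B j) \<subseteq> (\<Union>j<d. B j)" by (intro UN_mono) auto
      have "block_chain w m s B" using block_chain_mono[OF B(1) \<open>m \<le> d\<close>] .
      moreover have "(\<Union>j<m. B j) \<subseteq> R" using sub B(2) by blast
      moreover have "precedes w (\<Union>j<m. B j) {p}" using precedes_mono[OF B(3) sub] by simp
      ultimately show False using no that by blast
    qed
  qed
  have S0: "0 \<in> S w p" for w p by (simp add: S_def block_chain_def precedes_def)
  have Max_S: "Max (S w p) \<in> S w p" "\<And>d. d \<in> S w p \<Longrightarrow> d \<le> Max (S w p)" if "w \<in> {v, - v}" "p \<in> R" for w p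
    using S0[of w p] S_less[OF that] finite_subset[OF S_less[OF that]] by (auto intro: Max_in)
  define f where "f p = (Max (S v p), Max (S (- v) p))" for p
  have range: "f ` R \<subseteq> {..<m} \<times> {..<m}"
  proof -
    have "Max (S w p) < m" if "w \<in> {v, - v}" "p \<in> R" for w p
      using Max_S(1)[OF that] S_less[OF that] by blast
    then show ?thesis by (simp add: f_def image_subset_iff)
  qed
  have "card ({..<m} \<times> {..<m}) * (N - 1) < card R"
    using n by (simp add: card_cartesian_product power2_eq_square)
  then obtain y where y: "card {x \<in> R. f x = y} \<ge> N"
    using pigeonhole_class[OF R range] by blast
  let ?Q = "{x \<in> R. f x = y}"
  obtain w q p T where w: "w \<in> {v, - v}" and q: "q \<in> ?Q" and p: "p \<in> ?Q" and T: "T \<subseteq> ?Q" "card T = s"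
    "\<And>t. t \<in> T \<Longrightarrow> (t = q \<or> below w q t) \<and> below w t p"
    using step[OF _ y] by blast
  have "f q = f p" using p q by simp
  then have eq: "Max (S w q) = Max (S w p)" using w unfolding f_def by auto
  obtain B where B: "block_chain w (Max (S w q)) s B" "(\<Union>j<Max (S w q). B j) \<subseteq> R"
    "precedes w (\<Union>j<Max (S w q). B j) {q}"
    using Max_S(1)[OF w] q unfolding S_def by blast
  let ?d = "Max (S w q)"
  \<comment> \<open>The alternative \<open>t = q\<close> lets the block contain \<open>q\<close>
    itself, as it does for \<open>s = 1\<close> with the block \<open>{q}\<close>.\<close>
  have BT: "precedes w (\<Union>j<?d. B j) T"
    unfolding precedes_def
  proof (intro ballI)
    fix x t assume "x \<in> (\<Union>j<?d. B j)" "t \<in> T"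
    then have "below w x q" "t = q \<or> below w q t" using B(3) T(3) unfolding precedes_def by blast+
    then show "below w x t" using below_trans by blast
  qed
  have "finite T" using T(2) s card.infinite by force
  have "block_chain w (Suc ?d) s (B(?d := T))"
    by (rule block_chain_snoc[OF B(1) \<open>finite T\<close> T(2) BT])
  moreover have "(\<Union>j<Suc ?d. (B(?d := T)) j) \<subseteq> R"
    unfolding UN_less_Suc_upd using B(2) T(1) by blast
  moreover have "precedes w (\<Union>j<Suc ?d. (B(?d := T)) j) {p}"
  proof -
    obtain t where "t \<in> T" using T(2) s by fastforce
    then have "below w q p" using T(3) below_trans by blast
    then show ?thesis unfolding UN_less_Suc_upd precedes_def
      using B(3) T(3) below_trans unfolding precedes_def by blast
  qed
  ultimately have "Suc ?d \<in> S w p" unfolding S_def by blast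
  then have "Suc ?d \<le> Max (S w p)" using Max_S(2)[OF w] p by blast
  then show False using eq by simp
qed

text \<open>With \<open>k\<^sup>2\<close> pairs of labels, some class of equal labels has at least
  \<open>5 * s\<close> points, and there \<open>rectangle_many_points\<close> supplies the block
  between two points that \<open>deep_chain_below\<close> asks for.\<close>

lemma positive_fraction_Erdos_Szekeres:
  fixes v :: "nat \<Rightarrow> real"
  assumes "finite R" "inj_on v R" "s \<ge> 1" "k \<ge> 1" "card R \<ge> 5 * s * k\<^sup>2"
  shows "\<exists>w\<in>{v, - v}. \<exists>B. block_chain w k s B \<and> (\<Union>j<k. B j) \<subseteq> R"
proof -
  have "k\<^sup>2 * (5 * s - 1) < k\<^sup>2 * (5 * s)" using assms by (intro mult_less_mono2) auto
  then have "card R > k\<^sup>2 * (5 * s - 1)" using assms(5) by (metis mult.commute order.strict_trans2)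
  moreover have "\<exists>w\<in>{v, - v}. \<exists>q\<in>Q. \<exists>p\<in>Q. \<exists>T\<subseteq>Q. card T = s \<and> (\<forall>t\<in>T. (t = q \<or> below w q t) \<and> below w t p)"
    if "Q \<subseteq> R" "card Q \<ge> 5 * s" for Q
  proof -
    have "finite Q" "inj_on v Q" using that assms finite_subset inj_on_subset by blast+
    from rectangle_many_points[OF this that(2) assms(3)] show ?thesis by blast
  qed
  ultimately show ?thesis using deep_chain_below[OF assms(1,3), of k "5 * s" v] by blast
qed

text \<open>With single points as blocks, two points of equal labels already suffice, so
  \<open>deep_chain_below\<close> applies with \<open>N = 2\<close>. It is used for depth
  \<open>k - 1\<close>, with \<open>(k - 1)\<^sup>2\<close> pairs of labels, and the point
  \<open>p\<close> it returns serves as the last block.\<close>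

lemma Erdos_Szekeres_chain:
  fixes v :: "nat \<Rightarrow> real"
  assumes "finite R" "inj_on v R" "k \<ge> 1" "card R > (k - 1)\<^sup>2"
  shows "\<exists>w\<in>{v, - v}. \<exists>B. block_chain w k 1 B \<and> (\<Union>j<k. B j) \<subseteq> R"
proof -
  have "\<exists>w\<in>{v, - v}. \<exists>q\<in>Q. \<exists>p\<in>Q. \<exists>T\<subseteq>Q. card T = 1 \<and> (\<forall>t\<in>T. (t = q \<or> below w q t) \<and> below w t p)"
    if "Q \<subseteq> R" "card Q \<ge> 2" for Q
  proof -
    have "finite Q" using that(1) assms(1) finite_subset by blast
    moreover have "\<not> card Q \<le> Suc 0" using that(2) by simp
    ultimately obtain x y where xy: "x \<in> Q" "y \<in> Q" "x \<noteq> y"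
      using card_le_Suc0_iff_eq by blast
    then have "below v x y \<or> below v y x \<or> below (- v) x y \<or> below (- v) y x"
      using that(1) by (intro below_total[OF assms(2)]) auto
    then have "\<exists>w\<in>{v, - v}. below w x y \<or> below w y x" by simp
    then obtain w where w: "w \<in> {v, - v}" "below w x y \<or> below w y x" by blast
    have *: ?thesis if "below w q p" "q \<in> Q" "p \<in> Q" for q p
      using that w(1) by (intro bexI[of _ w] bexI[of _ q] bexI[of _ p] exI[of _ "{q}"] conjI) auto
    show ?thesis using w(2) *[of x y] *[of y x] xy by blast
  qed
  then obtain w p B where *: "w \<in> {v, - v}" "p \<in> R" "block_chain w (k - 1) 1 B" "(\<Union>j<k - 1. B j) \<subseteq> R"
    "precedes w (\<Union>j<k - 1. B j) {p}"
    using deep_chain_below[OF assms(1) le_refl, of "k - 1" 2 v] assms(4) by (metis One_nat_def diff_Suc_1 mult.right_neutral numeral_2_eq_2)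
  have "block_chain w (Suc (k - 1)) 1 (B(k - 1 := {p}))"
    by (rule block_chain_snoc[OF *(3)]) (use * in auto)
  moreover have "(\<Union>j<Suc (k - 1). (B(k - 1 := {p})) j) \<subseteq> R"
    unfolding UN_less_Suc_upd using * by blast
  moreover have "Suc (k - 1) = k" using assms(3) by simp
  ultimately show ?thesis using *(1) by metis
qed

section \<open>Greedy extraction of monotone parts\<close>

text \<open>If each round removes at least the fraction \<open>1 / (10 * k)\<close>, then by
  \<open>1 - y \<le> exp (- y)\<close> this many rounds shrink a set by the factor
  \<open>90 * k\<^sup>2\<close>.\<close>

definition extraction_steps :: "nat \<Rightarrow> nat" where
  "extraction_steps k = nat \<lceil>10 * real k * ln (90 * (real k)\<^sup>2)\<rceil>"

text \<open>Strict on purpose: if all pairs from two sets are comparable, the sets are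
  disjoint.\<close>

definition comparable :: "(nat \<Rightarrow> real) \<Rightarrow> nat \<Rightarrow> nat \<Rightarrow> bool" where
  "comparable v p q \<longleftrightarrow> below v p q \<or> below v q p"

text \<open>Rounding a quotient of at least 1 down to an integer loses less than a factor of
  2.\<close>

lemma less_2_mult_div:
  fixes n :: nat
  assumes "0 < m" "m \<le> n" shows "n < 2 * m * (n div m)"
proof -
  have "1 \<le> n div m" using assms by (simp add: Suc_le_eq div_greater_zero_iff)
  then have "m * 1 \<le> m * (n div m)" by (rule mult_le_mono2)
  moreover have "n mod m < m" using assms(1) by simp
  moreover have "n = m * (n div m) + n mod m" by simp
  ultimately show ?thesis by linarith
qed

text \<open>With \<open>n \<ge> 5 * k\<^sup>2\<close> points, blocks of size about
  \<open>n / (5 * k\<^sup>2)\<close> are available, and rounding makes the fraction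
  \<open>1 / (10 * k)\<close> out of \<open>1 / (5 * k)\<close>. With fewer points, \<open>k\<close>
  single points are already a large enough fraction.\<close>

lemma extraction_step:
  assumes "finite R" "inj_on v R" "k \<ge> 1" "card R > (k - 1)\<^sup>2"
  shows "\<exists>I\<subseteq>R. block_partitionable v k 1 I \<and> card R \<le> 10 * k * card I"
proof (cases "5 * k\<^sup>2 \<le> card R")
  case True
  define s where "s = card R div (5 * k\<^sup>2)"
  have "5 * k\<^sup>2 > 0" using assms(3) by simp
  then have s: "s \<ge> 1" "card R < 2 * (5 * k\<^sup>2) * s"
    using less_2_mult_div[OF _ True] True unfolding s_def by (simp_all add: Suc_le_eq div_greater_zero_iff)
  have "5 * k\<^sup>2 * s \<le> card R" unfolding s_def by simp
  then have "5 * s * k\<^sup>2 \<le> card R" by (simp add: mult.commute mult.left_commute)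
  then obtain w B where w: "w \<in> {v, - v}" and B: "block_chain w k s B" "(\<Union>j<k. B j) \<subseteq> R"
    using positive_fraction_Erdos_Szekeres[OF assms(1,2) s(1) assms(3)] by blast
  have "card R \<le> 10 * k * card (\<Union>j<k. B j)"
    using s(2) unfolding card_block_chain[OF B(1)] by (simp add: power2_eq_square mult.assoc)
  then show ?thesis using block_partitionable_chain[OF w B(1) assms(3) le_refl] B(2) by blast
next
  case False
  obtain w B where w: "w \<in> {v, - v}" and B: "block_chain w k 1 B" "(\<Union>j<k. B j) \<subseteq> R"
    using Erdos_Szekeres_chain[OF assms] by blast
  have "card R \<le> 10 * k * card (\<Union>j<k. B j)"
    using False unfolding card_block_chain[OF B(1)] by (simp add: power2_eq_square)
  then show ?thesis using block_partitionable_chain[OF w B(1) assms(3) le_refl] B(2) by blast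
qed

text \<open>Each round multiplies the size of the remainder by at most
  \<open>1 - 1 / (10 * k)\<close>. The first alternative is where the rounds stop: with at most
  \<open>(k - 1)\<^sup>2\<close> points left, a further chain of depth \<open>k\<close> is no longer
  guaranteed.\<close>

lemma extraction_iterated:
  assumes "finite R" "inj_on v R" "k \<ge> 1"
  shows "\<exists>X\<subseteq>R. block_partitionable v k c (R - X) \<and>
    (card X \<le> (k - 1)\<^sup>2 \<or> real (card X) \<le> real (card R) * (1 - 1 / (10 * real k)) ^ c)"
proof (induction c)
  case 0
  then show ?case by (intro exI[of _ R]) (simp add: block_partitionable_empty)
next
  case (Suc c)
  then obtain X where X: "X \<subseteq> R" "block_partitionable v k c (R - X)"
    "card X \<le> (k - 1)\<^sup>2 \<or> real (card X) \<le> real (card R) * (1 - 1 / (10 * real k)) ^ c"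
    by blast
  show ?case
  proof (cases "card X \<le> (k - 1)\<^sup>2")
    case True
    then show ?thesis using X block_partitionable_mono[OF X(2), of "Suc c"] by auto
  next
    case False
    have fin: "finite X" "inj_on v X" using X(1) assms finite_subset inj_on_subset by blast+
    obtain I where I: "I \<subseteq> X" "block_partitionable v k 1 I" "card X \<le> 10 * k * card I"
      using extraction_step[OF fin assms(3)] False by auto
    have "R - (X - I) = (R - X) \<union> I" using I(1) X(1) by blast
    moreover have "(R - X) \<inter> I = {}" using I(1) by blast
    ultimately have bp: "block_partitionable v k (Suc c) (R - (X - I))"
      using block_partitionable_Un[OF X(2) I(2)] by simp
    have "real (card X) \<le> real (10 * k * card I)" using I(3) of_nat_le_iff by blast
    then have "real (card X) / (10 * real k) \<le> real (card I)"
      using assms(3) by (simp add: field_simps)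
    moreover have "finite I" using I(1) fin finite_subset by blast
    then have "real (card (X - I)) = real (card X) - real (card I)"
      using I(1) fin(1) by (simp add: card_Diff_subset card_mono of_nat_diff)
    ultimately have "real (card (X - I)) \<le> real (card X) * (1 - 1 / (10 * real k))"
      by (simp add: field_simps)
    also have "\<dots> \<le> real (card R) * (1 - 1 / (10 * real k)) ^ c * (1 - 1 / (10 * real k))"
      using X(3) False assms(3) by (intro mult_right_mono) (auto simp: field_simps)
    finally have "real (card (X - I)) \<le> real (card R) * (1 - 1 / (10 * real k)) ^ Suc c"
      by (simp add: mult_ac)
    then show ?thesis using bp X(1) by blast
  qed
qed

text \<open>The factor \<open>90 * k\<^sup>2\<close> is what absorption requires: a chain of depth
  \<open>3 * k\<close> in \<open>n\<close> points can have blocks of size \<open>s\<close> with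
  \<open>n < 90 * k\<^sup>2 * s\<close>, so a remainder this small has fewer than \<open>s\<close>
  points.\<close>

lemma extraction:
  assumes "finite R" "inj_on v R" "k \<ge> 1"
  shows "\<exists>X\<subseteq>R. block_partitionable v k (extraction_steps k) (R - X) \<and>
    (card X \<le> (k - 1)\<^sup>2 \<or> card X * (90 * k\<^sup>2) \<le> card R)"
proof -
  let ?c = "extraction_steps k"
  let ?y = "1 / (10 * real k)"
  have pos: "90 * (real k)\<^sup>2 > 0" using assms(3) by simp
  have "10 * real k * ln (90 * (real k)\<^sup>2) \<le> real ?c"
    unfolding extraction_steps_def by (rule real_nat_ceiling_ge)
  then have c: "ln (90 * (real k)\<^sup>2) \<le> real ?c * ?y" using assms(3) by (simp add: field_simps)
  have "1 - ?y \<le> exp (- ?y)" using exp_ge_add_one_self[of "- ?y"] by simp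
  moreover have "0 \<le> 1 - ?y" using assms(3) by (simp add: field_simps)
  ultimately have "(1 - ?y) ^ ?c \<le> exp (- ?y) ^ ?c" by (intro power_mono)
  also have "\<dots> = exp (- (real ?c * ?y))" by (simp add: exp_of_nat_mult[symmetric])
  also have "\<dots> \<le> exp (- ln (90 * (real k)\<^sup>2))" using c by simp
  also have "\<dots> = 1 / (90 * (real k)\<^sup>2)" using pos by (simp add: exp_minus inverse_eq_divide)
  finally have le: "(1 - ?y) ^ ?c \<le> 1 / (90 * (real k)\<^sup>2)" .
  obtain X where X: "X \<subseteq> R" "block_partitionable v k ?c (R - X)"
    "card X \<le> (k - 1)\<^sup>2 \<or> real (card X) \<le> real (card R) * (1 - ?y) ^ ?c"
    using extraction_iterated[OF assms] by blast
  have "card X * (90 * k\<^sup>2) \<le> card R" if "real (card X) \<le> real (card R) * (1 - ?y) ^ ?c"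
  proof -
    have "real (card X) \<le> real (card R) * (1 / (90 * (real k)\<^sup>2))"
      using that mult_left_mono[OF le, of "real (card R)"] by linarith
    then have "real (card X) * (90 * (real k)\<^sup>2) \<le> real (card R)"
      using pos by (simp add: field_simps)
    then have "real (card X * (90 * k\<^sup>2)) \<le> real (card R)" by simp
    then show ?thesis using of_nat_le_iff by blast
  qed
  then show ?thesis using X by blast
qed

section \<open>Splitting off the middle third of a chain\<close>

text \<open>If all three fail, witnesses \<open>a\<close>, \<open>b\<close>, \<open>c\<close> from
  the three thirds satisfy \<open>a\<close> below \<open>b\<close> below \<open>c\<close> for
  \<open>w\<close>, and \<open>x\<close> is comparable to \<open>b\<close> for \<open>w\<close>. If
  \<open>b\<close> is below \<open>x\<close>, so is \<open>a\<close>; if \<open>x\<close> is below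
  \<open>b\<close>, it is below \<open>c\<close>. Both contradict the choice of witnesses.\<close>

lemma middle_third_trichotomy:
  assumes B: "block_chain w (3 * k) s B" and w: "inj_on w R" "(\<Union>j<3 * k. B j) \<subseteq> R"
    and x: "x \<in> R" "x \<notin> (\<Union>j<3 * k. B j)"
  shows "precedes w (\<Union>j<k. B j) {x} \<or> precedes w {x} (\<Union>j<k. B (2 * k + j)) \<or>
    (\<forall>m\<in>(\<Union>j<k. B (k + j)). comparable (- w) m x)"
proof (rule ccontr)
  assume neg: "\<not> ?thesis"
  have order: "below w p q" if "p \<in> B i" "q \<in> B j" "i < j" "j < 3 * k" for p q i j
    using B that unfolding block_chain_def precedes_def by blast
  have neq: "m \<noteq> x" "w m \<noteq> w x" if "m \<in> B j" "j < 3 * k" for m j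
  proof -
    have "m \<in> (\<Union>j<3 * k. B j)" using that by blast
    then show "m \<noteq> x" "w m \<noteq> w x" using x w by (auto simp: inj_on_eq_iff)
  qed
  obtain a i where a: "a \<in> B i" "i < k" "\<not> below w a x" using neg unfolding precedes_def by auto
  obtain c j where c: "c \<in> B (2 * k + j)" "j < k" "\<not> below w x c" using neg unfolding precedes_def by auto
  obtain b l where b: "b \<in> B (k + l)" "l < k" "\<not> comparable (- w) b x" using neg by blast
  have "below w a b" by (rule order[OF a(1) b(1)]) (use a b in auto)
  moreover have "below w b c" by (rule order[OF b(1) c(1)]) (use b c in auto)
  moreover have "b \<noteq> x" "w b \<noteq> w x" using neq[OF b(1)] b(2) by auto
  ultimately show False using a(3) b(3) c(3) unfolding comparable_def below_def by auto
qed

text \<open>One round of the iteration. The first and the last third each make two parts together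
  with the points they absorb, which accounts for the 4. The first alternative ends the iteration,
  with the leftover points deleted.\<close>

lemma extract_middle_chain:
  assumes R: "finite R" "inj_on v R" and k: "k \<ge> 1"
  shows "(\<exists>D\<subseteq>R. card D \<le> (k - 1)\<^sup>2 \<and> block_partitionable v k (extraction_steps k + 4) (R - D)) \<or>
    (\<exists>w\<in>{v, - v}. \<exists>s\<ge>1. \<exists>B. \<exists>X\<subseteq>R. block_chain w k s B \<and> (\<Union>j<k. B j) \<subseteq> R - X \<and> card X \<le> s \<and>
      (\<forall>m\<in>(\<Union>j<k. B j). \<forall>x\<in>X. comparable (- w) m x) \<and>
      block_partitionable v k (extraction_steps k + 4) (R - X - (\<Union>j<k. B j)))"
    (is "?done \<or> ?next")
proof (cases "45 * k\<^sup>2 \<le> card R")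
  case False
  obtain X where X: "X \<subseteq> R" "block_partitionable v k (extraction_steps k) (R - X)"
    "card X \<le> (k - 1)\<^sup>2 \<or> card X * (90 * k\<^sup>2) \<le> card R"
    using extraction[OF R k] by blast
  \<comment> \<open>With fewer than \<open>45 * k\<^sup>2\<close> points in \<open>R\<close>, a
    reduction by the factor \<open>90 * k\<^sup>2\<close> leaves nothing.\<close>
  have "card X = 0" if "card X * (90 * k\<^sup>2) \<le> card R"
  proof (rule ccontr)
    assume "card X \<noteq> 0"
    then have "1 * (90 * k\<^sup>2) \<le> card X * (90 * k\<^sup>2)" by (intro mult_le_mono1) simp
    then show False using that False by linarith
  qed
  then have "card X \<le> (k - 1)\<^sup>2" using X(3) by auto
  then have ?done using X(1) block_partitionable_mono[OF X(2), of "extraction_steps k + 4"] by auto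
  then show ?thesis ..
next
  case True
  \<comment> \<open>The depth is \<open>3 * k\<close>, and
    \<open>5 * (3 * k)\<^sup>2 = 45 * k\<^sup>2\<close>; rounding doubles this to
    \<open>90 * k\<^sup>2\<close>.\<close>
  define s where "s = card R div (45 * k\<^sup>2)"
  have "45 * k\<^sup>2 > 0" using k by simp
  then have s: "s \<ge> 1" "card R < 2 * (45 * k\<^sup>2) * s"
    using less_2_mult_div[OF _ True] True unfolding s_def by (simp_all add: Suc_le_eq div_greater_zero_iff)
  have "45 * k\<^sup>2 * s \<le> card R" unfolding s_def by simp
  then have "5 * s * (3 * k)\<^sup>2 \<le> card R" by (simp add: power2_eq_square mult_ac)
  then obtain w B where w: "w \<in> {v, - v}" and B: "block_chain w (3 * k) s B" "(\<Union>j<3 * k. B j) \<subseteq> R"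
    using positive_fraction_Erdos_Szekeres[OF R s(1), of "3 * k"] k by auto
  let ?U = "\<Union>j<3 * k. B j"
  define A M Z where "A = (\<Union>j<k. B j)" and "M = (\<Union>j<k. B (k + j))" and "Z = (\<Union>j<k. B (2 * k + j))"
  have chainA: "block_chain w k s B" by (rule block_chain_mono[OF B(1)]) simp
  have chainM: "block_chain w k s (\<lambda>j. B (k + j))" by (rule block_chain_shift[OF B(1)]) simp
  have chainZ: "block_chain w k s (\<lambda>j. B (2 * k + j))" by (rule block_chain_shift[OF B(1)]) simp
  have U: "?U = A \<union> M \<union> Z"
  proof
    show "?U \<subseteq> A \<union> M \<union> Z"
    proof
      fix x assume "x \<in> ?U"
      then obtain j where j: "j < 3 * k" "x \<in> B j" by blast
      consider "j < k" | "k \<le> j" "j < 2 * k" | "2 * k \<le> j" by linarith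
      then show "x \<in> A \<union> M \<union> Z"
      proof cases
        case 1
        then show ?thesis using j unfolding A_def by blast
      next
        case 2
        then have "x \<in> B (k + (j - k))" "j - k < k" using j by auto
        then show ?thesis unfolding M_def by blast
      next
        case 3
        then have "x \<in> B (2 * k + (j - 2 * k))" "j - 2 * k < k" using j by auto
        then show ?thesis unfolding Z_def by blast
      qed
    qed
    show "A \<union> M \<union> Z \<subseteq> ?U" unfolding A_def M_def Z_def by force
  qed
  have same: "i = j" if "x \<in> B i" "x \<in> B j" "i < 3 * k" "j < 3 * k" for x i j
    using block_chain_disjoint[OF B(1), of i j] that by blast
  have disj: "A \<inter> M = {}" "A \<inter> Z = {}" "M \<inter> Z = {}"
    unfolding A_def M_def Z_def by (force dest: same)+
  have finR': "finite (R - ?U)" "inj_on v (R - ?U)" using R by (auto intro: inj_on_subset)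
  obtain X where X: "X \<subseteq> R - ?U" "block_partitionable v k (extraction_steps k) (R - ?U - X)"
    "card X \<le> (k - 1)\<^sup>2 \<or> card X * (90 * k\<^sup>2) \<le> card (R - ?U)"
    using extraction[OF finR' k] by blast
  show ?thesis
  proof (cases "card X \<le> (k - 1)\<^sup>2")
    case True
    have "block_partitionable v k (extraction_steps k + 1) ((R - ?U - X) \<union> ?U)"
      by (rule block_partitionable_Un[OF X(2) block_partitionable_chain[OF w B(1) k]]) auto
    moreover have "(R - ?U - X) \<union> ?U = R - X" using X(1) B(2) by blast
    ultimately have "block_partitionable v k (extraction_steps k + 4) (R - X)"
      using block_partitionable_mono by fastforce
    then have ?done using True X(1) by blast
    then show ?thesis ..
  next
    case False
    then have "card X * (90 * k\<^sup>2) \<le> card (R - ?U)" using X(3) by blast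
    also have "\<dots> \<le> card R" using R by (intro card_mono) auto
    also have "\<dots> < s * (90 * k\<^sup>2)" using s(2) by (simp add: mult_ac)
    finally have Xs: "card X \<le> s" by simp
    have injw: "inj_on w R" using w R(2) by (auto simp: inj_on_def)
    \<comment> \<open>\<open>N\<close> extends the first third at its end and \<open>S\<close> the
      last third at its beginning. By the trichotomy, every point of \<open>Y\<close> is comparable
      for \<open>- w\<close> to the whole middle third.\<close>
    define N where "N = {x \<in> X. precedes w A {x}}"
    define S where "S = {x \<in> X - N. precedes w {x} Z}"
    define Y where "Y = X - N - S"
    have finX: "finite X" using X(1) finR' finite_subset by blast
    have sub: "N \<subseteq> X" "S \<subseteq> X" "Y \<subseteq> X" by (auto simp: N_def S_def Y_def)
    have NS: "finite N" "finite S" "card N \<le> s" "card S \<le> s" "card Y \<le> s"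
      using finite_subset[OF _ finX] order_trans[OF card_mono[OF finX] Xs] sub by blast+
    have comp: "\<forall>m\<in>M. \<forall>x\<in>Y. comparable (- w) m x"
    proof (intro ballI)
      fix m x assume "m \<in> M" "x \<in> Y"
      then show "comparable (- w) m x"
        using middle_third_trichotomy[OF B(1) injw B(2), of x] X(1)
        unfolding A_def[symmetric] M_def[symmetric] Z_def[symmetric]
        by (auto simp: Y_def N_def S_def)
    qed
    have "precedes w A N" unfolding N_def precedes_def by blast
    then have 1: "block_partitionable v k 2 (A \<union> N)"
      unfolding A_def by (intro block_partitionable_absorb[OF w chainA k]) (use NS in auto)
    have "precedes w S Z" unfolding S_def precedes_def by blast
    then have 2: "block_partitionable v k 2 (Z \<union> S)"
      unfolding Z_def by (intro block_partitionable_absorb[OF w chainZ k]) (use NS in auto)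
    have XU: "X \<inter> ?U = {}" using X(1) by blast
    have "block_partitionable v k (2 + 2) ((A \<union> N) \<union> (Z \<union> S))"
      by (rule block_partitionable_Un[OF 1 2]) (use disj XU U in \<open>auto simp: N_def S_def\<close>)
    then have "block_partitionable v k (extraction_steps k + (2 + 2)) ((R - ?U - X) \<union> ((A \<union> N) \<union> (Z \<union> S)))"
      by (rule block_partitionable_Un[OF X(2)]) (use U in \<open>auto simp: N_def S_def\<close>)
    moreover have "(R - ?U - X) \<union> ((A \<union> N) \<union> (Z \<union> S)) = R - Y - M"
      using disj XU U X(1) B(2) by (auto simp: N_def S_def Y_def)
    ultimately have bp: "block_partitionable v k (extraction_steps k + 4) (R - Y - M)" by simp
    have "M \<subseteq> R - Y" "Y \<subseteq> R" using XU U B(2) X(1) by (auto simp: Y_def)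
    then have ?next using w s(1) chainM NS(5) comp bp unfolding M_def by blast
    then show ?thesis ..
  qed
qed

section \<open>Chains seen from the opposite direction\<close>

lemma comparable_commute: "comparable v p q \<Longrightarrow> comparable v q p"
  by (auto simp: comparable_def)

lemma comparable_irrefl: "\<not> comparable v p p"
  by (simp add: comparable_def)

text \<open>Points of different blocks are ordered by \<open>w\<close>, so they cannot lie on
  opposite sides of \<open>x\<close> in the order of \<open>- w\<close>. Points of one block are
  compared by way of another block, which is where \<open>k \<ge> 2\<close> enters.\<close>

lemma chain_one_side:
  assumes B: "block_chain w k s B" "k \<ge> 2" "s \<ge> 1"
    and comp: "\<And>m. m \<in> (\<Union>j<k. B j) \<Longrightarrow> comparable (- w) m x"
  shows "precedes (- w) {x} (\<Union>j<k. B j) \<or> precedes (- w) (\<Union>j<k. B j) {x}"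
proof -
  have order: "below w p q \<or> below w q p" if "p \<in> B i" "q \<in> B j" "i \<noteq> j" "i < k" "j < k" for p q i j
    using B(1) that unfolding block_chain_def precedes_def by (metis nat_neq_iff)
  have step: "below (- w) x q" if "below (- w) x p" "p \<in> B i" "q \<in> B j" "i \<noteq> j" "i < k" "j < k" for p q i j
  proof (rule ccontr)
    assume "\<not> ?thesis"
    then have "below (- w) q x" using comp[of q] that unfolding comparable_def by blast
    then have "below (- w) q p" using that(1) below_trans by blast
    then show False using below_uminus_contr order that by blast
  qed
  have "B j \<noteq> {}" if "j < k" for j using B(1,3) that unfolding block_chain_def by fastforce
  then obtain p0 p1 where p: "p0 \<in> B 0" "p1 \<in> B 1" using B(2) by (metis all_not_in_conv less_le_trans one_less_numeral_iff pos2 semiring_norm(76))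
  have k: "0 < k" "1 < k" using B(2) by auto
  \<comment> \<open>Since \<open>step\<close> only leads from one block to a different one, the way
    from \<open>p\<close> to \<open>q\<close> goes through \<open>p0\<close>, with a detour through
    \<open>p1\<close> whenever an end lies in block 0.\<close>
  have all: "below (- w) x q" if "below (- w) x p" "p \<in> B i" "i < k" "q \<in> B j" "j < k" for p q i j
  proof -
    have 0: "below (- w) x p0"
    proof (cases "i = 0")
      case True
      then have "below (- w) x p1" using step[OF that(1,2) p(2)] k by simp
      then show ?thesis using step[OF _ p(2) p(1)] k by simp
    qed (use step[OF that(1,2) p(1)] that(3) k in simp)
    show ?thesis
    proof (cases "j = 0")
      case True
      have "below (- w) x p1" using step[OF 0 p(1,2)] k by simp
      then show ?thesis using step[OF _ p(2) that(4)] True k by simp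
    qed (use step[OF 0 p(1) that(4)] that(5) k in simp)
  qed
  show ?thesis
  proof (cases "below (- w) x p0")
    case True
    then have "precedes (- w) {x} (\<Union>j<k. B j)"
      unfolding precedes_def using all[OF True p(1) k(1)] by blast
    then show ?thesis ..
  next
    case False
    have "below (- w) m x" if "m \<in> B j" "j < k" for m j
    proof -
      have "\<not> below (- w) x m" using all[OF _ that p(1) k(1)] False by blast
      then show ?thesis using comp[of m] that unfolding comparable_def by blast
    qed
    then have "precedes (- w) (\<Union>j<k. B j) {x}" unfolding precedes_def by blast
    then show ?thesis ..
  qed
qed

text \<open>The position of one pair \<open>m\<close>, \<open>m'\<close> decides everything: by
  \<open>chain_one_side\<close> it fixes the side of \<open>m\<close> on which the second chain
  lies, and then, for each point of the second chain, the side on which the first chain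
  lies.\<close>

lemma chains_one_side:
  assumes B: "block_chain w k s B" "s \<ge> 1" and B': "block_chain w k s' B'" "s' \<ge> 1" and k: "k \<ge> 2"
    and comp: "\<And>m m'. m \<in> (\<Union>j<k. B j) \<Longrightarrow> m' \<in> (\<Union>j<k. B' j) \<Longrightarrow> comparable (- w) m m'"
  shows "precedes (- w) (\<Union>j<k. B j) (\<Union>j<k. B' j) \<or> precedes (- w) (\<Union>j<k. B' j) (\<Union>j<k. B j)"
proof -
  let ?M = "\<Union>j<k. B j" and ?M' = "\<Union>j<k. B' j"
  have "B 0 \<noteq> {}" "B' 0 \<noteq> {}" using B B' k unfolding block_chain_def by fastforce+
  then obtain m m' where m: "m \<in> ?M" "m' \<in> ?M'" using k by fastforce
  have 1: "precedes (- w) {x} ?M' \<or> precedes (- w) ?M' {x}" if "x \<in> ?M" for x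
    by (rule chain_one_side[OF B'(1) k B'(2)]) (use comp that comparable_commute in blast)
  have 2: "precedes (- w) {x} ?M \<or> precedes (- w) ?M {x}" if "x \<in> ?M'" for x
    by (rule chain_one_side[OF B(1) k B(2)]) (use comp that in blast)
  have asym: "\<not> (below (- w) p q \<and> below (- w) q p)" for p q by (auto simp: below_def)
  show ?thesis
  proof (cases "below (- w) m m'")
    case True
    then have "below (- w) m x" if "x \<in> ?M'" for x
      using 1[OF m(1)] m(2) that asym unfolding precedes_def by blast
    then have "below (- w) y x" if "x \<in> ?M'" "y \<in> ?M" for x y
      using 2[OF that(1)] m(1) that asym unfolding precedes_def by blast
    then show ?thesis unfolding precedes_def by blast
  next
    case False
    then have "below (- w) m' m" using comp[OF m] unfolding comparable_def by blast
    then have "below (- w) x m" if "x \<in> ?M'" for x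
      using 1[OF m(1)] m(2) that asym unfolding precedes_def by blast
    then have "below (- w) x y" if "x \<in> ?M'" "y \<in> ?M" for x y
      using 2[OF that(1)] m(1) that asym unfolding precedes_def by blast
    then show ?thesis unfolding precedes_def by blast
  qed
qed

section \<open>Absorbing a set by \<open>k\<close> chains of one direction\<close>

lemma split_set_by_cards:
  fixes m :: nat
  assumes "finite U" "card U = (\<Sum>g<m. n g)"
  shows "\<exists>T. (\<forall>g<m. card (T g) = n g) \<and> (\<Union>g<m. T g) = U \<and> (\<forall>g<m. \<forall>h<m. g \<noteq> h \<longrightarrow> T g \<inter> T h = {})"
  using assms
proof (induction m arbitrary: U)
  case 0
  then show ?case by simp
next
  case (Suc m)
  then have "n m \<le> card U" by simp
  then obtain V where V: "V \<subseteq> U" "card V = n m" "finite V" using obtain_subset_with_card_n by metis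
  have "card (U - V) = (\<Sum>g<m. n g)" using V Suc.prems by (simp add: card_Diff_subset)
  then obtain T where T: "\<forall>g<m. card (T g) = n g" "(\<Union>g<m. T g) = U - V"
    "\<forall>g<m. \<forall>h<m. g \<noteq> h \<longrightarrow> T g \<inter> T h = {}"
    using Suc.IH[of "U - V"] Suc.prems(1) by blast
  have "T g \<inter> V = {}" if "g < m" for g using T(2) that by blast
  moreover have "(\<Union>g<Suc m. (T(m := V)) g) = U" unfolding UN_less_Suc_upd T(2) using V(1) by blast
  ultimately show ?case using T(1,3) V(2)
    by (intro exI[of _ "T(m := V)"]) (auto simp: less_Suc_eq)
qed

text \<open>
  The points of \<open>X\<close> above the same number of chains form a single block in a monotone sequence
  with \<open>k\<close> further blocks, one taken out of each chain. Taking the same number of points from all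
  blocks of a chain makes up to \<open>k - 1\<close> points per chain too many; these form a sequence of their own.
\<close>

lemma block_partitionable_absorb_many:
  fixes J :: "nat set"
  assumes k: "k \<ge> 2" and J: "finite J" "card J = k" and w: "w \<in> {v, - v}"
    and B: "\<And>i. i \<in> J \<Longrightarrow> block_chain w k (s i) (B i)"
    and X: "finite X" "X \<noteq> {}" "\<And>i. i \<in> J \<Longrightarrow> card X \<le> s i"
    and compX: "\<And>i x m. i \<in> J \<Longrightarrow> x \<in> X \<Longrightarrow> m \<in> (\<Union>l<k. B i l) \<Longrightarrow> comparable (- w) m x"
    and compB: "\<And>i j m m'. i \<in> J \<Longrightarrow> j \<in> J \<Longrightarrow> i \<noteq> j \<Longrightarrow>
      m \<in> (\<Union>l<k. B i l) \<Longrightarrow> m' \<in> (\<Union>l<k. B j l) \<Longrightarrow> comparable (- w) m m'"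
  shows "block_partitionable v k (2 * k + 2) (X \<union> (\<Union>i\<in>J. \<Union>l<k. B i l))"
proof -
  define M where "M i = (\<Union>l<k. B i l)" for i
  have cX: "card X \<ge> 1" using X(1,2) by (simp add: Suc_le_eq card_gt_0_iff)
  have s: "s i \<ge> 1" if "i \<in> J" for i using X(3)[OF that] cX by linarith
  have w': "- w \<in> {v, - v}" using uminus_mem_orientations[OF w] .
  have sideX: "precedes (- w) (M i) {x} \<or> precedes (- w) {x} (M i)" if "i \<in> J" "x \<in> X" for i x
    using chain_one_side[OF B k s, of i x] compX that unfolding M_def by blast
  have sideM: "precedes (- w) (M i) (M j) \<or> precedes (- w) (M j) (M i)" if "i \<in> J" "j \<in> J" "i \<noteq> j" for i j
    using chains_one_side[OF B s B s k, of i j] compB that unfolding M_def by blast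
  have Mne: "M i \<noteq> {}" if "i \<in> J" for i
    using card_block_chain[OF B[OF that]] s[OF that] k unfolding M_def by force
  have MX: "M i \<inter> X = {}" if "i \<in> J" for i
    using compX[OF that] comparable_irrefl unfolding M_def by blast
  have MM: "M i \<inter> M j = {}" if "i \<in> J" "j \<in> J" "i \<noteq> j" for i j
    using compB[OF that] comparable_irrefl unfolding M_def by blast
  define sig where "sig x = {i \<in> J. precedes (- w) (M i) {x}}" for x
  \<comment> \<open>Otherwise \<open>M i\<close>, \<open>x\<close>, \<open>M j\<close>,
    \<open>y\<close> and again \<open>M i\<close> would form a cycle for \<open>- w\<close>. The
    sets \<open>sig x\<close> are thus nested and determined by their cardinality, which leaves only
    \<open>k + 1\<close> classes \<open>G g\<close>.\<close>
  have sig_chain: "sig x \<subseteq> sig y \<or> sig y \<subseteq> sig x" if xy: "x \<in> X" "y \<in> X" for x y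
  proof (rule ccontr)
    assume "\<not> ?thesis"
    then obtain i j where ij: "i \<in> J" "j \<in> J" "precedes (- w) (M i) {x}" "\<not> precedes (- w) (M i) {y}"
      "precedes (- w) (M j) {y}" "\<not> precedes (- w) (M j) {x}" unfolding sig_def by blast
    obtain a b where ab: "a \<in> M i" "b \<in> M j" using Mne ij by blast
    have "below (- w) a x" "below (- w) x b" "below (- w) b y" "below (- w) y a"
      using ij ab sideX[OF ij(1) xy(2)] sideX[OF ij(2) xy(1)] unfolding precedes_def by blast+
    then have "below (- w) a a" using below_trans by blast
    then show False by simp
  qed
  have sig_sub: "sig x \<subseteq> J" for x by (auto simp: sig_def)
  define G where "G g = {x \<in> X. card (sig x) = g}" for g
  have sig_eq: "sig x = sig y" if "x \<in> G g" "y \<in> G g" for x y g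
  proof -
    have "x \<in> X" "y \<in> X" "card (sig x) = card (sig y)" using that by (auto simp: G_def)
    moreover have "finite (sig x)" "finite (sig y)" using finite_subset[OF sig_sub J(1)] by blast+
    ultimately show ?thesis using sig_chain card_subset_eq by metis
  qed
  have G_Un: "(\<Union>g<k + 1. G g) = X"
    using card_mono[OF J(1) sig_sub] J(2) unfolding G_def by (auto simp: less_Suc_eq_le)
  \<comment> \<open>\<open>card X / k\<close> rounded up: taking \<open>q\<close> points from each
    of the \<open>k\<close> blocks of a chain gives at least \<open>card X\<close> points, and
    \<open>q \<le> card X\<close> fits into a block. Equal portions keep the rest of each chain a
    chain for \<open>w\<close>.\<close>
  define q where "q = (card X + k - 1) div k"
  have kq: "card X \<le> k * q" "q \<le> card X"
  proof -
    have "card X + k - 1 < k * (q + 1)" unfolding q_def using k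
      by (metis Suc_eq_plus1 dividend_less_times_div less_le_trans mult_Suc_right pos2 add.commute)
    then show "card X \<le> k * q" by (simp add: algebra_simps)
    have "card X + k - 1 \<le> k * card X"
    proof -
      obtain a b where "card X = Suc a" "k = Suc b" using cX k by (metis Suc_le_D One_nat_def Suc_1)
      then show ?thesis by simp
    qed
    then show "q \<le> card X" unfolding q_def using k
      by (metis div_le_mono less_le_trans nonzero_mult_div_cancel_left not_less0 pos2 )
  qed
  have "\<exists>C. C \<subseteq> B i l \<and> card C = q" if "i \<in> J" "l < k" for i l
  proof -
    have "q \<le> card (B i l)" using B[OF that(1)] that(2) X(3)[OF that(1)] kq(2) unfolding block_chain_def by auto
    then show ?thesis by (meson obtain_subset_with_card_n)
  qed
  then obtain C where C: "\<And>i l. i \<in> J \<Longrightarrow> l < k \<Longrightarrow> C i l \<subseteq> B i l \<and> card (C i l) = q" by metis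
  define U where "U i = (\<Union>l<k. C i l)" for i
  define D where "D i l = B i l - C i l" for i l
  have chainC: "block_chain w k q (C i)" if "i \<in> J" for i
    by (rule block_chain_subsets[OF B[OF that]]) (use C that in blast)
  have chainD: "block_chain w k (s i - q) (D i)" if "i \<in> J" for i
  proof (rule block_chain_subsets[OF B[OF that]])
    fix l assume l: "l < k"
    have "finite (B i l)" "card (B i l) = s i" using B[OF that] l by (auto simp: block_chain_def)
    moreover from this have "finite (C i l)" using C[OF that l] finite_subset by blast
    ultimately show "D i l \<subseteq> B i l \<and> card (D i l) = s i - q"
      using C[OF that l] by (simp add: D_def card_Diff_subset)
  qed
  have U: "finite (U i)" "card (U i) = k * q" "U i \<subseteq> M i" "M i - U i = (\<Union>l<k. D i l)" if "i \<in> J" for i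
  proof -
    show "finite (U i)" "card (U i) = k * q"
      using finite_block_chain[OF chainC[OF that]] card_block_chain[OF chainC[OF that]] by (auto simp: U_def)
    show "U i \<subseteq> M i" using C[OF that] unfolding U_def M_def by blast
    have "x \<notin> C i l'" if "x \<in> B i l" "x \<notin> C i l" "l < k" "l' < k" for x l l'
      using block_chain_disjoint[OF B[OF \<open>i \<in> J\<close>], of l l'] C[OF \<open>i \<in> J\<close>, of l'] that by blast
    then show "M i - U i = (\<Union>l<k. D i l)"
      unfolding M_def U_def D_def by blast
  qed
  \<comment> \<open>The indices up to \<open>k\<close> belong to the classes of \<open>X\<close>.
    The extra index \<open>k + 1\<close> has an empty class and receives the surplus
    \<open>k * q - card X\<close> of each chain.\<close>
  define G' where "G' g = (if g < k + 1 then G g else {})" for g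
  define n where "n g = (if g < k + 1 then card (G g) else k * q - card X)" for g
  have "(\<Sum>g<k + 1. card (G g)) = card (\<Union>g<k + 1. G g)"
    by (rule card_UN_disjoint[symmetric]) (use X(1) in \<open>auto simp: G_def\<close>)
  then have "(\<Sum>g<k + 1. n g) = card X" unfolding G_Un by (simp add: n_def)
  then have "(\<Sum>g<k + 2. n g) = k * q" using kq(1) by (simp add: n_def)
  then have "\<exists>T. (\<forall>g<k + 2. card (T g) = n g) \<and> (\<Union>g<k + 2. T g) = U i \<and>
      (\<forall>g<k + 2. \<forall>h<k + 2. g \<noteq> h \<longrightarrow> T g \<inter> T h = {})" if "i \<in> J" for i
    using split_set_by_cards[OF U(1)[OF that], of n "k + 2"] U(2)[OF that] by metis
  then obtain T where T: "\<And>i g. i \<in> J \<Longrightarrow> g < k + 2 \<Longrightarrow> card (T i g) = n g"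
    "\<And>i. i \<in> J \<Longrightarrow> (\<Union>g<k + 2. T i g) = U i"
    "\<And>i g h. i \<in> J \<Longrightarrow> g < k + 2 \<Longrightarrow> h < k + 2 \<Longrightarrow> g \<noteq> h \<Longrightarrow> T i g \<inter> T i h = {}"
    by metis
  have TM: "T i g \<subseteq> M i" "finite (T i g)" if "i \<in> J" "g < k + 2" for i g
  proof -
    have "T i g \<subseteq> U i" using T(2)[OF that(1)] that(2) by blast
    then show "T i g \<subseteq> M i" "finite (T i g)" using U(1,3)[OF that(1)] finite_subset by blast+
  qed
  have TT: "precedes (- w) (T i g) (T j g) \<or> precedes (- w) (T j g) (T i g)"
    if "i \<in> J" "j \<in> J" "i \<noteq> j" "g < k + 2" for i j g
    using sideM[OF that(1-3)] precedes_mono[OF _ TM(1)[OF that(1,4)] TM(1)[OF that(2,4)]]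
      precedes_mono[OF _ TM(1)[OF that(2,4)] TM(1)[OF that(1,4)]] by blast
  \<comment> \<open>All points of a class have the same \<open>sig\<close>, so they lie on the same
    side of \<open>M i\<close>, whichever points of \<open>M i\<close> are dealt to that
    class.\<close>
  have TG: "precedes (- w) (T i g) (G g) \<or> precedes (- w) (G g) (T i g)" if "i \<in> J" "g < k + 2" for i g
  proof (cases "\<exists>x\<in>G g. i \<in> sig x")
    case True
    then have "precedes (- w) (M i) {x}" if "x \<in> G g" for x using sig_eq that unfolding sig_def by blast
    then show ?thesis using TM(1)[OF that] unfolding precedes_def by blast
  next
    case False
    then have "precedes (- w) {x} (M i)" if "x \<in> G g" for x
      using sideX[OF \<open>i \<in> J\<close>, of x] that \<open>i \<in> J\<close> unfolding sig_def G_def by blast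
    then show ?thesis using TM(1)[OF that] unfolding precedes_def by blast
  qed
  define A where "A g = G' g \<union> (\<Union>i\<in>J. T i g)" for g
  \<comment> \<open>For \<open>g \<le> k\<close>, the class \<open>G g\<close> and an equally large
    portion of each chain are \<open>k + 1\<close> blocks, pairwise ordered by \<open>- w\<close>.
    For \<open>g = k + 1\<close> there are just the \<open>k\<close> surplus portions.\<close>
  have bpA: "block_partitionable v k 1 (A g)" if g: "g < k + 2" for g
  proof (cases "g < k + 1")
    case False
    have 1: "finite (T i g) \<and> card (T i g) = n g" if "i \<in> J" for i
      using T(1)[OF that g] TM(2)[OF that g] by blast
    have "\<exists>E. block_chain (- w) (card J) (n g) E \<and> (\<Union>j<card J. E j) = (\<Union>i\<in>J. T i g)"
      by (rule block_chain_linear_family[OF J(1)]; intro 1 TT[OF _ _ _ g])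
    then obtain E where E: "block_chain (- w) (card J) (n g) E" "(\<Union>j<card J. E j) = (\<Union>i\<in>J. T i g)"
      by blast
    have "block_partitionable v k 1 (\<Union>j<card J. E j)"
      by (rule block_partitionable_chain[OF w' E(1)]) (use J k in auto)
    then show ?thesis unfolding E(2) A_def G'_def using False by simp
  next
    case True
    \<comment> \<open>A fresh index, under which \<open>G g\<close> joins the family of
      portions.\<close>
    obtain a where a: "a \<notin> J" using J(1) ex_new_if_finite[OF infinite_UNIV_nat] by blast
    define F where "F i = (if i = a then G g else T i g)" for i
    have 1: "finite (F i) \<and> card (F i) = n g" if "i \<in> insert a J" for i
    proof (cases "i = a")
      case True
      then show ?thesis using X(1) \<open>g < k + 1\<close> by (simp add: F_def n_def G_def)
    next
      case False
      then show ?thesis using that T(1)[OF _ g] TM(2)[OF _ g] by (simp add: F_def)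
    qed
    have 2: "precedes (- w) (F i) (F j) \<or> precedes (- w) (F j) (F i)"
      if "i \<in> insert a J" "j \<in> insert a J" "i \<noteq> j" for i j
      using that TT[OF _ _ _ g] TG[OF _ g] a unfolding F_def by auto
    have c: "card (insert a J) = Suc k" using J a by simp
    have "\<exists>E. block_chain (- w) (Suc k) (n g) E \<and> (\<Union>j<Suc k. E j) = (\<Union>i\<in>insert a J. F i)"
      unfolding c[symmetric] by (rule block_chain_linear_family; (intro 1 2)?) (use J(1) in simp)
    then obtain E where E: "block_chain (- w) (Suc k) (n g) E" "(\<Union>j<Suc k. E j) = (\<Union>i\<in>insert a J. F i)"
      by blast
    have "block_partitionable v k 1 (\<Union>j<Suc k. E j)"
      by (rule block_partitionable_chain[OF w' E(1)]) (use k in auto)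
    moreover have "(\<Union>i\<in>insert a J. F i) = A g"
      unfolding A_def G'_def using True a by (auto simp: F_def)
    ultimately show ?thesis unfolding E(2) by simp
  qed
  have A_disj: "A g \<inter> A h = {}" if "g < k + 2" "h < k + 2" "g \<noteq> h" for g h
  proof -
    have "G' g \<inter> G' h = {}" "G' g \<subseteq> X" "G' h \<subseteq> X" using that by (auto simp: G'_def G_def)
    moreover have "T i g \<inter> T j h = {}" if "i \<in> J" "j \<in> J" for i j
      using T(3)[OF that(1) \<open>g < k + 2\<close> \<open>h < k + 2\<close> \<open>g \<noteq> h\<close>] MM[OF that] TM(1)[OF that(1) \<open>g < k + 2\<close>]
        TM(1)[OF that(2) \<open>h < k + 2\<close>] by (cases "i = j") auto
    moreover have "T i g \<inter> X = {}" "T i h \<inter> X = {}" if "i \<in> J" for i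
      using TM(1)[OF that \<open>g < k + 2\<close>] TM(1)[OF that \<open>h < k + 2\<close>] MX[OF that] by auto
    ultimately show ?thesis unfolding A_def by blast
  qed
  have "(\<Union>g<k + 2. G' g) = X"
  proof -
    have "G g \<subseteq> (\<Union>g<k + 2. G' g)" if "g < k + 1" for g
    proof
      fix x assume "x \<in> G g"
      then have "x \<in> G' g" "g < k + 2" using that by (simp_all add: G'_def)
      then show "x \<in> (\<Union>g<k + 2. G' g)" by blast
    qed
    moreover have "G' g \<subseteq> (\<Union>g<k + 1. G g)" for g unfolding G'_def by auto
    ultimately have "(\<Union>g<k + 2. G' g) = (\<Union>g<k + 1. G g)" by blast
    then show ?thesis using G_Un by simp
  qed
  moreover have "(\<Union>g<k + 2. \<Union>i\<in>J. T i g) = (\<Union>i\<in>J. U i)" using T(2) by blast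
  ultimately have A_Un: "(\<Union>g<k + 2. A g) = X \<union> (\<Union>i\<in>J. U i)" unfolding A_def UN_Un_distrib by simp
  \<comment> \<open>The sets \<open>A g\<close> give \<open>k + 2\<close> parts, the remainders of
    the chains another \<open>k\<close>.\<close>
  have 1: "block_partitionable v k (\<Sum>g<k + 2. 1) (\<Union>g<k + 2. A g)"
    by (rule block_partitionable_UN) (use bpA A_disj in auto)
  have 2: "block_partitionable v k (\<Sum>i\<in>J. 1) (\<Union>i\<in>J. M i - U i)"
  proof (rule block_partitionable_UN[OF J(1)])
    fix i assume i: "i \<in> J"
    show "block_partitionable v k 1 (M i - U i)"
      unfolding U(4)[OF i] by (rule block_partitionable_chain[OF w chainD[OF i]]) (use k in auto)
  qed (use MM in blast)
  have disj: "(X \<union> (\<Union>i\<in>J. U i)) \<inter> (\<Union>i\<in>J. M i - U i) = {}"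
  proof -
    have "x \<notin> M j - U j" if "x \<in> U i" "i \<in> J" "j \<in> J" for x i j
      using U(3)[OF that(2)] MM[OF that(2,3)] that by (cases "i = j") auto
    then show ?thesis using MX by blast
  qed
  have "block_partitionable v k ((\<Sum>g<k + 2. 1) + (\<Sum>i\<in>J. 1)) ((X \<union> (\<Union>i\<in>J. U i)) \<union> (\<Union>i\<in>J. M i - U i))"
    by (rule block_partitionable_Un[OF 1[unfolded A_Un] 2 disj])
  moreover have "(X \<union> (\<Union>i\<in>J. U i)) \<union> (\<Union>i\<in>J. M i - U i) = X \<union> (\<Union>i\<in>J. M i)"
    using U(3) by blast
  ultimately show ?thesis using J(2) unfolding M_def by (simp add: mult_2)
qed

section \<open>Iteration of the rounds\<close>

text \<open>
  Invariant of the iteration: the parts \<open>\<Union>l<k. B i l\<close> have been set aside, \<open>X\<close> still has to be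
  partitioned, and everything else is already partitioned.
\<close>

definition level_system :: "(nat \<Rightarrow> real) \<Rightarrow> nat \<Rightarrow> nat set \<Rightarrow> nat \<Rightarrow> nat set \<Rightarrow> (nat \<Rightarrow> nat \<Rightarrow> real) \<Rightarrow>
    (nat \<Rightarrow> nat) \<Rightarrow> (nat \<Rightarrow> nat \<Rightarrow> nat set) \<Rightarrow> bool" where
  "level_system v k R n X W S B \<longleftrightarrow> X \<subseteq> R \<and>
     (\<forall>i<n. W i \<in> {v, - v} \<and> block_chain (W i) k (S i) (B i) \<and> (\<Union>l<k. B i l) \<subseteq> R - X \<and> card X \<le> S i \<and>
       (\<forall>m\<in>(\<Union>l<k. B i l). \<forall>x\<in>X. comparable (- W i) m x)) \<and>
     (\<forall>j<n. \<forall>i<j. \<forall>m\<in>(\<Union>l<k. B i l). \<forall>x\<in>(\<Union>l<k. B j l). comparable (- W i) m x) \<and>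
     block_partitionable v k (n * (extraction_steps k + 4)) (R - X - (\<Union>i<n. \<Union>l<k. B i l))"

text \<open>Two chains set aside are comparable in all pairs of their points, and
  \<open>comparable\<close> is irreflexive.\<close>

lemma level_system_disjoint:
  assumes "level_system v k R n X W S B" "i < n" "j < n" "i \<noteq> j"
  shows "(\<Union>l<k. B i l) \<inter> (\<Union>l<k. B j l) = {}"
proof -
  have *: "(\<Union>l<k. B i l) \<inter> (\<Union>l<k. B j l) = {}" if "i < j" "j < n" for i j
  proof -
    have "\<forall>m\<in>(\<Union>l<k. B i l). \<forall>x\<in>(\<Union>l<k. B j l). comparable (- W i) m x"
      using assms(1) that unfolding level_system_def by blast
    then show ?thesis using comparable_irrefl by blast
  qed
  show ?thesis using *[of i j] *[of j i] assms(2-4) by (cases "i < j") auto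
qed

lemma level_system_chains:
  assumes "level_system v k R n X W S B" "k \<ge> 1" "I \<subseteq> {..<n}"
  shows "block_partitionable v k (card I) (\<Union>i\<in>I. \<Union>l<k. B i l)"
proof -
  have "block_partitionable v k (\<Sum>i\<in>I. 1) (\<Union>i\<in>I. \<Union>l<k. B i l)"
  proof (rule block_partitionable_UN)
    show "finite I" using assms(3) finite_subset by blast
    show "block_partitionable v k 1 (\<Union>l<k. B i l)" if "i \<in> I" for i
    proof -
      have "W i \<in> {v, - v}" "block_chain (W i) k (S i) (B i)"
        using assms(1,3) that unfolding level_system_def by blast+
      then show ?thesis using block_partitionable_chain assms(2) by blast
    qed
    show "(\<Union>l<k. B i l) \<inter> (\<Union>l<k. B j l) = {}" if "i \<in> I" "j \<in> I" "i \<noteq> j" for i j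
      by (rule level_system_disjoint[OF assms(1)]) (use that assms(3) in auto)
  qed
  then show ?thesis by simp
qed

text \<open>The new chain lies in \<open>X\<close>, so its comparability to the earlier chains is
  inherited from that of \<open>X\<close>. As \<open>Y\<close> is a subset of \<open>X\<close>, it
  still fits into the earlier block-sizes.\<close>

lemma level_system_Suc:
  assumes L: "level_system v k R n X W S B"
    and w: "w \<in> {v, - v}" and B': "block_chain w k s B'" and M: "(\<Union>l<k. B' l) \<subseteq> X - Y"
    and Y: "Y \<subseteq> X" "card Y \<le> s" and X: "finite X"
    and comp: "\<forall>m\<in>(\<Union>l<k. B' l). \<forall>x\<in>Y. comparable (- w) m x"
    and bp: "block_partitionable v k (extraction_steps k + 4) (X - Y - (\<Union>l<k. B' l))"
  shows "level_system v k R (Suc n) Y (W(n := w)) (S(n := s)) (B(n := B'))"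
proof -
  let ?M = "\<lambda>i. \<Union>l<k. B i l" and ?M' = "\<Union>l<k. B' l"
  have XR: "X \<subseteq> R" using L by (simp add: level_system_def)
  have old: "W i \<in> {v, - v}" "block_chain (W i) k (S i) (B i)" "?M i \<subseteq> R - X" "card X \<le> S i"
    "\<And>m x. m \<in> ?M i \<Longrightarrow> x \<in> X \<Longrightarrow> comparable (- W i) m x" if "i < n" for i
    using L that unfolding level_system_def by blast+
  have oldM: "comparable (- W i) m x" if "j < n" "i < j" "m \<in> ?M i" "x \<in> ?M j" for i j m x
    using L that unfolding level_system_def by blast
  have cY: "card Y \<le> card X" using Y X by (simp add: card_mono)
  have 1: "block_partitionable v k (n * (extraction_steps k + 4)) (R - X - (\<Union>i<n. ?M i))"
    using L by (simp add: level_system_def)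
  have "block_partitionable v k (n * (extraction_steps k + 4) + (extraction_steps k + 4))
      ((R - X - (\<Union>i<n. ?M i)) \<union> (X - Y - ?M'))"
    by (rule block_partitionable_Un[OF 1 bp]) auto
  moreover have "(R - X - (\<Union>i<n. ?M i)) \<union> (X - Y - ?M') = R - Y - (\<Union>i<Suc n. \<Union>l<k. (B(n := B')) i l)"
  proof -
    have "(\<Union>i<n. \<Union>l<k. (B(n := B')) i l) = (\<Union>i<n. ?M i)" by (intro SUP_cong) auto
    then have "(\<Union>i<Suc n. \<Union>l<k. (B(n := B')) i l) = (\<Union>i<n. ?M i) \<union> ?M'"
      unfolding lessThan_Suc UN_insert by (simp add: Un_commute)
    moreover have "(\<Union>i<n. ?M i) \<inter> X = {}" using old(3) by blast
    moreover have "(R - X - A) \<union> (X - Y - N) = R - Y - (A \<union> N)" if "A \<inter> X = {}" "N \<subseteq> X - Y" for A N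
      using that Y(1) XR by auto
    ultimately show ?thesis using M by presburger
  qed
  ultimately have bp': "block_partitionable v k (Suc n * (extraction_steps k + 4))
      (R - Y - (\<Union>i<Suc n. \<Union>l<k. (B(n := B')) i l))" by (simp add: add.commute)
  have A: "(W(n := w)) i \<in> {v, - v} \<and> block_chain ((W(n := w)) i) k ((S(n := s)) i) ((B(n := B')) i) \<and>
      (\<Union>l<k. (B(n := B')) i l) \<subseteq> R - Y \<and> card Y \<le> (S(n := s)) i \<and>
      (\<forall>m\<in>(\<Union>l<k. (B(n := B')) i l). \<forall>x\<in>Y. comparable (- (W(n := w)) i) m x)" if "i < Suc n" for i
  proof (cases "i = n")
    case True
    have "?M' \<subseteq> R - Y" using M XR by blast
    then show ?thesis using True w B' Y(2) comp by simp
  next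
    case False
    then have i: "i < n" using that by simp
    have "?M i \<subseteq> R - Y" "card Y \<le> S i" "\<forall>m\<in>?M i. \<forall>x\<in>Y. comparable (- W i) m x"
      using old(3-5)[OF i] Y(1) cY by (blast, linarith, blast)
    then show ?thesis using old(1,2)[OF i] False by simp
  qed
  have C: "comparable (- (W(n := w)) i) m x"
    if "j < Suc n" "i < j" "m \<in> (\<Union>l<k. (B(n := B')) i l)" "x \<in> (\<Union>l<k. (B(n := B')) j l)" for i j m x
  proof (cases "j = n")
    case True
    then have "m \<in> ?M i" "x \<in> X" "i < n" using that M by auto
    then show ?thesis using old(5) by simp
  next
    case False
    then have "m \<in> ?M i" "x \<in> ?M j" "j < n" "i < j" using that by auto
    then show ?thesis using oldM by simp
  qed
  show ?thesis
    unfolding level_system_def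
  proof (intro conjI[OF _ conjI[OF _ conjI]])
    show "Y \<subseteq> R" using Y(1) XR by (rule order_trans)
  qed ((intro allI impI, rule A, assumption), (intro allI impI ballI, rule C, assumption+), rule bp')
qed

text \<open>When the iteration ends early, the chains set aside so far become parts. This costs one
  more part per round, hence 5 in place of 4.\<close>

lemma level_system_exists:
  assumes R: "finite R" "inj_on v R" and k: "k \<ge> 1"
  shows "(\<exists>D\<subseteq>R. card D \<le> (k - 1)\<^sup>2 \<and> block_partitionable v k (n * (extraction_steps k + 5)) (R - D)) \<or>
    (\<exists>X W S B. level_system v k R n X W S B)"
proof (induction n)
  case 0
  \<comment> \<open>No chain is set aside yet, so the three functions have no values to
    specify.\<close>
  have "level_system v k R 0 R undefined undefined undefined"
    by (simp add: level_system_def block_partitionable_empty)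
  then show ?case by blast
next
  case (Suc n)
  let ?c = "extraction_steps k"
  show ?case
  proof (cases "\<exists>D\<subseteq>R. card D \<le> (k - 1)\<^sup>2 \<and> block_partitionable v k (n * (?c + 5)) (R - D)")
    case True
    then obtain D where D: "D \<subseteq> R" "card D \<le> (k - 1)\<^sup>2" "block_partitionable v k (n * (?c + 5)) (R - D)"
      by blast
    have "n * (?c + 5) \<le> Suc n * (?c + 5)" by simp
    then show ?thesis using D(1,2) block_partitionable_mono[OF D(3)] by blast
  next
    case False
    then obtain X W S B where L: "level_system v k R n X W S B" using Suc.IH by blast
    have XR: "X \<subseteq> R" using L by (simp add: level_system_def)
    then have fin: "finite X" "inj_on v X" using R finite_subset inj_on_subset by blast+
    from extract_middle_chain[OF fin k] show ?thesis
    proof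
      assume "\<exists>D\<subseteq>X. card D \<le> (k - 1)\<^sup>2 \<and> block_partitionable v k (?c + 4) (X - D)"
      then obtain D where D: "D \<subseteq> X" "card D \<le> (k - 1)\<^sup>2" "block_partitionable v k (?c + 4) (X - D)"
        by blast
      let ?M = "\<Union>i<n. \<Union>l<k. B i l"
      have M: "?M \<subseteq> R - X" using L unfolding level_system_def by blast
      have 1: "block_partitionable v k n ?M" using level_system_chains[OF L k, of "{..<n}"] by simp
      have 2: "block_partitionable v k (n * (?c + 4)) (R - X - ?M)" using L by (simp add: level_system_def)
      have 3: "block_partitionable v k (n * (?c + 4) + (?c + 4)) ((R - X - ?M) \<union> (X - D))"
        by (rule block_partitionable_Un[OF 2 D(3)]) blast
      have "block_partitionable v k (n * (?c + 4) + (?c + 4) + n) ((R - X - ?M) \<union> (X - D) \<union> ?M)"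
        by (rule block_partitionable_Un[OF 3 1]) (use M in blast)
      moreover have "(R - X - ?M) \<union> (X - D) \<union> ?M = R - D" using M D(1) XR by blast
      moreover have "n * (?c + 4) + (?c + 4) + n \<le> Suc n * (?c + 5)" by (simp add: algebra_simps)
      ultimately have "block_partitionable v k (Suc n * (?c + 5)) (R - D)"
        using block_partitionable_mono by metis
      then show ?thesis using D(1,2) XR by blast
    next
      assume "\<exists>w\<in>{v, - v}. \<exists>s\<ge>1. \<exists>B. \<exists>Y\<subseteq>X. block_chain w k s B \<and> (\<Union>j<k. B j) \<subseteq> X - Y \<and> card Y \<le> s \<and>
        (\<forall>m\<in>(\<Union>j<k. B j). \<forall>x\<in>Y. comparable (- w) m x) \<and>
        block_partitionable v k (?c + 4) (X - Y - (\<Union>j<k. B j))"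
      then obtain w s B' Y where *: "w \<in> {v, - v}" "block_chain w k s B'" "(\<Union>l<k. B' l) \<subseteq> X - Y" "Y \<subseteq> X"
        "card Y \<le> s" "\<forall>m\<in>(\<Union>l<k. B' l). \<forall>x\<in>Y. comparable (- w) m x"
        "block_partitionable v k (?c + 4) (X - Y - (\<Union>l<k. B' l))"
        by blast
      from level_system_Suc[OF L *(1-5) fin(1) *(6,7)] show ?thesis by blast
    qed
  qed
qed

text \<open>Among \<open>2 * k\<close> chains, \<open>k\<close> have the same direction; they absorb
  \<open>X\<close> in \<open>2 * k + 2\<close> parts. The other \<open>k\<close> chains are parts
  themselves, which gives \<open>3 * k + 2\<close> on top of the cost of the rounds.\<close>

lemma block_partition_bound:
  assumes R: "finite R" "inj_on v R" and k: "k \<ge> 2"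
  shows "\<exists>D\<subseteq>R. card D \<le> (k - 1)\<^sup>2 \<and>
    block_partitionable v k (2 * k * (extraction_steps k + 5) + 3 * k + 2) (R - D)"
proof -
  let ?c = "extraction_steps k"
  let ?T = "2 * k * (?c + 5) + 3 * k + 2"
  have k1: "k \<ge> 1" using k by simp
  from level_system_exists[OF R k1, of "2 * k"] show ?thesis
  proof
    assume "\<exists>D\<subseteq>R. card D \<le> (k - 1)\<^sup>2 \<and> block_partitionable v k (2 * k * (?c + 5)) (R - D)"
    then obtain D where D: "D \<subseteq> R" "card D \<le> (k - 1)\<^sup>2" "block_partitionable v k (2 * k * (?c + 5)) (R - D)"
      by blast
    then show ?thesis using block_partitionable_mono[OF D(3), of ?T] by auto
  next
    assume "\<exists>X W S B. level_system v k R (2 * k) X W S B"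
    then obtain X W S B where L: "level_system v k R (2 * k) X W S B" by blast
    let ?M = "\<lambda>i. \<Union>l<k. B i l"
    have XR: "X \<subseteq> R" using L by (simp add: level_system_def)
    then have finX: "finite X" using R finite_subset by blast
    have W: "W i \<in> {v, - v}" "block_chain (W i) k (S i) (B i)" "?M i \<subseteq> R - X" "card X \<le> S i"
      "\<And>m x. m \<in> ?M i \<Longrightarrow> x \<in> X \<Longrightarrow> comparable (- W i) m x" if "i < 2 * k" for i
      using L that unfolding level_system_def by blast+
    have WM: "comparable (- W i) m x" if "j < 2 * k" "i < j" "m \<in> ?M i" "x \<in> ?M j" for i j m x
      using L that unfolding level_system_def by blast
    have rest: "block_partitionable v k (2 * k * (?c + 4)) (R - X - (\<Union>i<2 * k. ?M i))"
      using L by (simp add: level_system_def)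
    have "\<exists>w\<in>{v, - v}. k \<le> card {i. i < 2 * k \<and> W i = w}"
    proof (rule ccontr)
      assume "\<not> ?thesis"
      then have "card {i. i < 2 * k \<and> W i = v} < k" "card {i. i < 2 * k \<and> W i = - v} < k" by auto
      moreover have eq: "{..<2 * k} = {i. i < 2 * k \<and> W i = v} \<union> {i. i < 2 * k \<and> W i = - v}"
        using W(1) by blast
      have "2 * k \<le> card {i. i < 2 * k \<and> W i = v} + card {i. i < 2 * k \<and> W i = - v}"
        using card_Un_le[of "{i. i < 2 * k \<and> W i = v}" "{i. i < 2 * k \<and> W i = - v}"]
        unfolding eq[symmetric] by simp
      ultimately show False by linarith
    qed
    then obtain w J where w: "w \<in> {v, - v}" and J: "J \<subseteq> {i. i < 2 * k \<and> W i = w}" "card J = k" "finite J"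
      by (meson obtain_subset_with_card_n)
    have J2: "i < 2 * k" "W i = w" if "i \<in> J" for i using J(1) that by auto
    have absorb: "block_partitionable v k (2 * k + 2) (X \<union> (\<Union>i\<in>J. ?M i))"
    \<comment> \<open>With nothing to absorb, the chains of \<open>J\<close> are simply parts
      themselves.\<close>
    proof (cases "X = {}")
      case True
      have "block_partitionable v k (card J) (\<Union>i\<in>J. ?M i)"
        by (rule level_system_chains[OF L k1]) (use J2 in auto)
      then show ?thesis using True J(2) block_partitionable_mono by fastforce
    next
      case False
      show ?thesis
      proof (rule block_partitionable_absorb_many[OF k J(3,2) w _ finX False])
        fix i assume i: "i \<in> J"
        show "block_chain w k (S i) (B i)" "card X \<le> S i"
          using W(2,4)[OF J2(1)[OF i]] J2(2)[OF i] by auto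
        fix x m assume "x \<in> X" "m \<in> ?M i"
        then show "comparable (- w) m x" using W(5)[OF J2(1)[OF i]] J2(2)[OF i] by metis
      next
        fix i j m m' assume ij: "i \<in> J" "j \<in> J" "i \<noteq> j" and m: "m \<in> ?M i" "m' \<in> ?M j"
        show "comparable (- w) m m'"
        proof (cases "i < j")
          case True
          then show ?thesis using WM[OF J2(1)[OF ij(2)] True m] J2(2)[OF ij(1)] by simp
        next
          case False
          then have "j < i" using ij(3) by simp
          then show ?thesis using WM[OF J2(1)[OF ij(1)] \<open>j < i\<close> m(2,1)] J2(2)[OF ij(2)]
            by (simp add: comparable_commute)
        qed
      qed
    qed
    let ?I = "{..<2 * k} - J"
    have "J \<subseteq> {..<2 * k}" using J2 by auto
    then have "card ?I = k" using J by (simp add: card_Diff_subset)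
    then have others: "block_partitionable v k k (\<Union>i\<in>?I. ?M i)"
      using level_system_chains[OF L k1, of ?I] by simp
    have "?M i \<inter> ?M j = {}" if "i \<in> J" "j \<in> ?I" for i j
      by (rule level_system_disjoint[OF L]) (use that J2 in auto)
    moreover have "?M i \<inter> X = {}" if "i < 2 * k" for i using W(3)[OF that] by blast
    ultimately have "(X \<union> (\<Union>i\<in>J. ?M i)) \<inter> (\<Union>i\<in>?I. ?M i) = {}" by blast
    from block_partitionable_Un[OF absorb others this]
    have 1: "block_partitionable v k (2 * k + 2 + k) (X \<union> (\<Union>i\<in>J. ?M i) \<union> (\<Union>i\<in>?I. ?M i))" .
    have eq: "X \<union> (\<Union>i\<in>J. ?M i) \<union> (\<Union>i\<in>?I. ?M i) = X \<union> (\<Union>i<2 * k. ?M i)"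
      using \<open>J \<subseteq> {..<2 * k}\<close> by blast
    have "block_partitionable v k (2 * k * (?c + 4) + (2 * k + 2 + k))
        ((R - X - (\<Union>i<2 * k. ?M i)) \<union> (X \<union> (\<Union>i<2 * k. ?M i)))"
      by (rule block_partitionable_Un[OF rest 1[unfolded eq]]) blast
    moreover have "(R - X - (\<Union>i<2 * k. ?M i)) \<union> (X \<union> (\<Union>i<2 * k. ?M i)) = R - {}"
      using XR W(3) by blast
    moreover have "2 * k * (?c + 4) + (2 * k + 2 + k) \<le> ?T" by simp
    ultimately have "block_partitionable v k ?T (R - {})"
      using block_partitionable_mono[of v k "2 * k * (?c + 4) + (2 * k + 2 + k)" "R - {}" ?T] by argo
    \<comment> \<open>When all rounds are carried out, no point is deleted.\<close>
    then show ?thesis by (intro exI[of _ "{}"]) auto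
  qed
qed

section \<open>Numerical estimates\<close>

text \<open>This lets the logarithm swallow lower-order terms.\<close>

lemma one_le_ln_Suc:
  assumes "k \<ge> (2::nat)" shows "1 \<le> ln (real k + 1)"
proof -
  have "exp 1 \<le> real k + 1" using exp_le assms by linarith
  then show ?thesis using ln_ge_iff[of "real k + 1" 1] by simp
qed

text \<open>From \<open>90 \<le> 3 ^ 5\<close> one gets
  \<open>90 * k\<^sup>2 \<le> (k + 1) ^ 7\<close>, whence \<open>70 = 10 * 7\<close>; the ceiling
  adds the 1.\<close>

lemma extraction_steps_le:
  assumes "k \<ge> 2" shows "real (extraction_steps k) \<le> 70 * real k * ln (real k + 1) + 1"
proof -
  have k: "real k \<ge> 2" using assms by simp
  have "(90::real) \<le> 3 ^ 5" by simp
  also have "\<dots> \<le> (real k + 1) ^ 5" using k by (intro power_mono) auto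
  finally have "90 * (real k)\<^sup>2 \<le> (real k + 1) ^ 5 * (real k + 1)\<^sup>2"
    using k by (intro mult_mono power_mono) auto
  also have "\<dots> = (real k + 1) ^ 7" by (simp flip: power_add)
  finally have "ln (90 * (real k)\<^sup>2) \<le> ln ((real k + 1) ^ 7)"
    using k by (intro ln_mono) auto
  also have "\<dots> = 7 * ln (real k + 1)" using k by (simp add: ln_realpow)
  finally have "10 * real k * ln (90 * (real k)\<^sup>2) \<le> 10 * real k * (7 * ln (real k + 1))"
    using k by (intro mult_left_mono) auto
  moreover have "ln (90 * (real k)\<^sup>2) \<ge> 0"
  proof -
    have "1 \<le> (real k)\<^sup>2" using k by (intro one_le_power) simp
    then show ?thesis by (intro ln_ge_zero) simp
  qed
  then have "0 \<le> 10 * real k * ln (90 * (real k)\<^sup>2)" using k by simp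
  ultimately show ?thesis unfolding extraction_steps_def by linarith
qed

text \<open>The main term has \<open>140 = 2 * 70\<close>. The linear terms add up to
  \<open>2 * k + 10 * k + 3 * k = 15 * k\<close>, and \<open>15 * k + 2 \<le> 20 * k\<^sup>2\<close>
  supplies the other 20.\<close>

lemma block_count_le:
  assumes "k \<ge> 2"
  shows "real (2 * k * (extraction_steps k + 5) + 3 * k + 2) \<le> 160 * (real k)\<^sup>2 * ln (real k + 1)"
proof -
  define L where "L = ln (real k + 1)"
  have L: "1 \<le> L" using one_le_ln_Suc[OF assms] by (simp add: L_def)
  have k: "real k \<ge> 2" using assms by simp
  have "2 * real k * real (extraction_steps k) \<le> 2 * real k * (70 * real k * L + 1)"
    using extraction_steps_le[OF assms] unfolding L_def by (intro mult_left_mono) auto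
  then have "real (2 * k * (extraction_steps k + 5) + 3 * k + 2) \<le> 140 * (real k)\<^sup>2 * L + 15 * real k + 2"
    by (simp add: algebra_simps power2_eq_square)
  also have "15 * real k + 2 \<le> 20 * (real k)\<^sup>2"
  proof -
    have "2 * real k \<le> real k * real k" using k by (intro mult_right_mono) auto
    then show ?thesis using k unfolding power2_eq_square by linarith
  qed
  then have "140 * (real k)\<^sup>2 * L + 15 * real k + 2 \<le> 140 * (real k)\<^sup>2 * L + 20 * (real k)\<^sup>2 * 1" by simp
  also have "\<dots> \<le> 140 * (real k)\<^sup>2 * L + 20 * (real k)\<^sup>2 * L"
    using L by (intro add_left_mono mult_left_mono) auto
  also have "\<dots> = 160 * (real k)\<^sup>2 * L" by simp
  finally show ?thesis unfolding L_def .
qed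

section \<open>Conclusion for lists of reals\<close>

text \<open>A single block carries no order condition. This settles \<open>k = 1\<close>, where no
  deletion is allowed.\<close>

lemma block_partitionable_depth_1:
  assumes "finite R" shows "block_partitionable v 1 1 R"
proof -
  have "block_chain v 1 (card R) (\<lambda>_. R)" using assms by (simp add: block_chain_def)
  from block_partitionable_chain[OF _ this, of v 1] show ?thesis by (simp add: lessThan_Suc)
qed

lemma partition_into_block_monotone:
  assumes "k \<ge> 1" "distinct xs"
  shows "\<exists>D P. D \<subseteq> {..<length xs} \<and> card D \<le> (k - 1)\<^sup>2 \<and>
    partition_on ({..<length xs} - D) P \<and>
    real (card P) \<le> 160 * (real k)\<^sup>2 * ln (real k + 1) \<and>
    (\<forall>I\<in>P. \<exists>d s. d \<ge> k \<and> block_monotone d s (nths xs I))"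
proof -
  let ?R = "{..<length xs}"
  have inj: "inj_on ((!) xs) ?R" using assms(2) by (auto simp: inj_on_def nth_eq_iff_index_eq)
  have "\<exists>D\<subseteq>?R. \<exists>c. card D \<le> (k - 1)\<^sup>2 \<and> real c \<le> 160 * (real k)\<^sup>2 * ln (real k + 1) \<and>
    block_partitionable ((!) xs) k c (?R - D)"
  proof (cases "k = 1")
    case True
    \<comment> \<open>For \<open>k = 1\<close> the bound is \<open>160 * ln 2\<close>, which has to
      allow for one part.\<close>
    have "ln (1 / 2) \<le> 1 / 2 - (1::real)" by (rule ln_le_minus_one) simp
    moreover have "ln (1 / 2) = - ln (2::real)" by (simp add: ln_div)
    ultimately have "1 / 2 \<le> ln (2::real)" by linarith
    then have "real 1 \<le> 160 * (real k)\<^sup>2 * ln (real k + 1)" using True by simp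
    moreover have "block_partitionable ((!) xs) k 1 (?R - {})"
      using block_partitionable_depth_1 True by simp
    ultimately show ?thesis by (intro exI[of _ "{}"] exI[of _ 1] conjI) auto
  next
    case False
    then have "k \<ge> 2" using assms(1) by simp
    then show ?thesis using block_partition_bound[OF _ inj, of k] block_count_le by blast
  qed
  then obtain D c where D: "D \<subseteq> ?R" "card D \<le> (k - 1)\<^sup>2" "real c \<le> 160 * (real k)\<^sup>2 * ln (real k + 1)"
    "block_partitionable ((!) xs) k c (?R - D)" by blast
  then obtain P where P: "partition_on (?R - D) P" "card P \<le> c" "\<forall>I\<in>P. block_monotone_set ((!) xs) k I"
    unfolding block_partitionable_def by blast
  have "\<exists>d s. d \<ge> k \<and> block_monotone d s (nths xs I)" if "I \<in> P" for I
  proof (rule block_monotone_nths[OF assms(2,1)])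
    show "I \<subseteq> ?R" using partition_onD1[OF P(1)] that by blast
  qed (use P(3) that in blast)
  moreover have "real (card P) \<le> 160 * (real k)\<^sup>2 * ln (real k + 1)" using P(2) D(3) by linarith
  ultimately show ?thesis using D(1,2) P(1) by blast
qed

theorem theorem1p2:
  shows "\<exists>C::real. C > 0 \<and>
    (\<forall>k::nat. k \<ge> 1 \<longrightarrow>
      (\<forall>xs::real list. distinct xs \<longrightarrow>
        (\<exists>D P. D \<subseteq> {..<length xs} \<and> card D \<le> (k - 1)\<^sup>2 \<and>
          partition_on ({..<length xs} - D) P \<and>
          real (card P) \<le> C * (real k)\<^sup>2 * ln (real k + 1) \<and>
          (\<forall>I\<in>P. \<exists>d s. d \<ge> k \<and> block_monotone d s (nths xs I)))))"
  using partition_into_block_monotone by (intro exI[of _ 160]) auto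

end
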